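(* Let $X$ be a separable Hilbert space and let $A:D(A)\subset X\to X$ be a densely defined linear operator such that: (a) $A$ is self-adjoint; (b) $\langle Ax,x\rangle\ge0$ for all $x\in D(A)$; (c) there is $\lambda>0$ such that $(\lambda I+A)^{-1}:X\to X$ is compact. Let $B:X\to X$ be a bounded linear operator. Let $\{A,B\}$ be $1$-null controllable in any time $T>0$, with control cost satisfying, for some constants $\nu,T_0>0$, $$N(\tau)\le e^{\nu/\tau}\qquad\text{for all }0<\tau\le T_0.$$ Then there exists a constant $r_1>0$ such that for any $R>0$ there exists $T_R>0$ such that for all $u_0\in X$ with $$|\langle u_0,\varphi_1\rangle-1|<r_1,\qquad\|u_0-\langle u_0,\varphi_1\rangle\varphi_1\|\le R,$$ the problem $$u'(t)+Au(t)+p(t)Bu(t)=0,\quad t>0,\qquad u(0)=u_0,$$ is exactly controllable to the first eigensolution $\psi_1(t)=e^{-\lambda_1t}\varphi_1$ in time $T_R$, i.e. there exists $p\in L^2(0,T_R)$ such that the solution satisfies $u(T_R)=\psi_1(T_R)$.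
   Context: $\mathbb{N}^*=\{1,2,3,\dots\}$. The spectrum of $A$ consists of a sequence of eigenvalues $\{\lambda_k\}_{k\in\mathbb{N}^*}$, ordered so that $0\le\lambda_k\le\lambda_{k+1}\to\infty$, and $\{\varphi_k\}_{k\in\mathbb{N}^*}$ are corresponding eigenfunctions, $A\varphi_k=\lambda_k\varphi_k$, $\|\varphi_k\|=1$, forming an orthonormal basis of $X$. Controls $p$ are scalar functions of time. Solutions are mild solutions: $u\in C([0,T];X)$ with $u(t)=e^{-tA}u_0-\int_0^te^{-(t-s)A}p(s)Bu(s)\,ds$. For $y_0\in X$, $p\in L^2(0,T)$, let $y(\cdot;y_0,p)$ be the mild solution of the linear problem $y'(t)+Ay(t)+p(t)B\varphi_1=0$ on $[0,T]$, $y(0)=y_0$. The pair $\{A,B\}$ is $1$-null controllable in time $T>0$ if there is a constant $N_T>0$ such that for every $y_0\in X$ there is $p\in L^2(0,T)$ with $\|p\|_{L^2(0,T)}\le N_T\|y_0\|$ and $y(T;y_0,p)=0$. The control cost is $$N(T)=\sup_{\|y_0\|=1}\inf\{\|p\|_{L^2(0,T)}: y(T;y_0,p)=0\}.$$ *)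

theory Defs
  imports "HOL-Analysis.Analysis"
begin

section \<open>Unbounded operators\<close>

text \<open>
  An unbounded operator is a pair of a domain \<open>D\<close> and a total function \<open>A\<close> whose values outside
  \<open>D\<close> are irrelevant.
\<close>

definition densely_defined_linear :: "'a::real_inner set \<Rightarrow> ('a \<Rightarrow> 'a) \<Rightarrow> bool" where
  "densely_defined_linear D A \<longleftrightarrow>
     subspace D \<and> closure D = UNIV \<and>
     (\<forall>x\<in>D. \<forall>y\<in>D. A (x + y) = A x + A y) \<and>
     (\<forall>c. \<forall>x\<in>D. A (c *\<^sub>R x) = c *\<^sub>R A x)"

definition adjoint_dom :: "'a::real_inner set \<Rightarrow> ('a \<Rightarrow> 'a) \<Rightarrow> 'a set" where
  "adjoint_dom D A = {y. \<exists>z. \<forall>x\<in>D. A x \<bullet> y = x \<bullet> z}"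

definition adjoint_op :: "'a::real_inner set \<Rightarrow> ('a \<Rightarrow> 'a) \<Rightarrow> 'a \<Rightarrow> 'a" where
  "adjoint_op D A y = (THE z. \<forall>x\<in>D. A x \<bullet> y = x \<bullet> z)"

definition self_adjoint :: "'a::real_inner set \<Rightarrow> ('a \<Rightarrow> 'a) \<Rightarrow> bool" where
  "self_adjoint D A \<longleftrightarrow> adjoint_dom D A = D \<and> (\<forall>y\<in>D. adjoint_op D A y = A y)"

definition compact_operator :: "('a::real_normed_vector \<Rightarrow> 'a) \<Rightarrow> bool" where
  "compact_operator K \<longleftrightarrow> linear K \<and> (\<forall>V. bounded V \<longrightarrow> compact (closure (K ` V)))"

definition has_compact_inverse :: "'a::real_normed_vector set \<Rightarrow> ('a \<Rightarrow> 'a) \<Rightarrow> bool" where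
  "has_compact_inverse D L \<longleftrightarrow> bij_betw L D UNIV \<and> compact_operator (the_inv_into D L)"

text \<open>Eigenpairs are indexed by the positive integers; the values at index \<open>0\<close> are unconstrained.\<close>

definition orthonormal_basis_seq :: "(nat \<Rightarrow> 'a::real_inner) \<Rightarrow> bool" where
  "orthonormal_basis_seq \<phi> \<longleftrightarrow>
     (\<forall>k\<ge>1. norm (\<phi> k) = 1) \<and>
     (\<forall>j\<ge>1. \<forall>k\<ge>1. j \<noteq> k \<longrightarrow> \<phi> j \<bullet> \<phi> k = 0) \<and>
     closure (span (\<phi> ` {1..})) = UNIV"

definition eigenbasis ::
    "'a::real_inner set \<Rightarrow> ('a \<Rightarrow> 'a) \<Rightarrow> (nat \<Rightarrow> real) \<Rightarrow> (nat \<Rightarrow> 'a) \<Rightarrow> bool" where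
  "eigenbasis D A ev \<phi> \<longleftrightarrow>
     (\<forall>k\<ge>1. 0 \<le> ev k \<and> ev k \<le> ev (Suc k)) \<and>
     filterlim ev at_top sequentially \<and>
     (\<forall>k\<ge>1. \<phi> k \<in> D \<and> A (\<phi> k) = ev k *\<^sub>R \<phi> k) \<and>
     orthonormal_basis_seq \<phi>"


section \<open>Semigroups\<close>

definition c0_semigroup :: "(real \<Rightarrow> 'a::real_normed_vector \<Rightarrow> 'a) \<Rightarrow> bool" where
  "c0_semigroup S \<longleftrightarrow>
     (\<forall>t\<ge>0. bounded_linear (S t)) \<and>
     (\<forall>x. S 0 x = x) \<and>
     (\<forall>s\<ge>0. \<forall>t\<ge>0. \<forall>x. S (s + t) x = S s (S t x)) \<and>
     (\<forall>x. ((\<lambda>t. S t x) \<longlongrightarrow> x) (at_right 0))"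

definition has_generator ::
    "(real \<Rightarrow> 'a::real_normed_vector \<Rightarrow> 'a) \<Rightarrow> 'a set \<Rightarrow> ('a \<Rightarrow> 'a) \<Rightarrow> bool" where
  "has_generator S D G \<longleftrightarrow>
     D = {x. \<exists>y. ((\<lambda>h. (S h x - x) /\<^sub>R h) \<longlongrightarrow> y) (at_right 0)} \<and>
     (\<forall>x\<in>D. ((\<lambda>h. (S h x - x) /\<^sub>R h) \<longlongrightarrow> G x) (at_right 0))"

text \<open>
  \<open>exp_semigroup D A t\<close> is \<open>e\<^sup>-\<^sup>t\<^sup>A\<close>. A strongly continuous semigroup is determined for \<open>t \<ge> 0\<close> by its
  generator, so the choice is immaterial there; negative times are never used.
\<close>

definition exp_semigroup ::
    "'a::real_normed_vector set \<Rightarrow> ('a \<Rightarrow> 'a) \<Rightarrow> real \<Rightarrow> 'a \<Rightarrow> 'a" where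
  "exp_semigroup D A = (SOME S. c0_semigroup S \<and> has_generator S D (\<lambda>x. - A x))"


section \<open>Controls and mild solutions\<close>

text \<open>Elements of \<open>L\<^sup>2(0,T)\<close> are given by Borel representatives.\<close>

definition L2_control :: "real \<Rightarrow> (real \<Rightarrow> real) \<Rightarrow> bool" where
  "L2_control T p \<longleftrightarrow>
     set_borel_measurable lborel {0..T} p \<and> set_integrable lborel {0..T} (\<lambda>t. (p t)\<^sup>2)"

definition L2_norm_control :: "real \<Rightarrow> (real \<Rightarrow> real) \<Rightarrow> real" where
  "L2_norm_control T p = sqrt (LBINT t:{0..T}. (p t)\<^sup>2)"

text \<open>
  \<open>u\<close> is a mild solution on \<open>[0,T]\<close> of \<open>u'(t) + A u(t) + f(t) = 0\<close>, \<open>u(0) = u0\<close>.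
\<close>

definition mild_solution ::
    "'a::{real_inner,banach,second_countable_topology} set \<Rightarrow> ('a \<Rightarrow> 'a) \<Rightarrow> real \<Rightarrow>
     (real \<Rightarrow> 'a) \<Rightarrow> 'a \<Rightarrow> (real \<Rightarrow> 'a) \<Rightarrow> bool" where
  "mild_solution D A T f u0 u \<longleftrightarrow>
     continuous_on {0..T} u \<and>
     (\<forall>t\<in>{0..T}. u t = exp_semigroup D A t u0 - (LBINT s:{0..t}. exp_semigroup D A (t - s) (f s)))"

definition bilinear_solution ::
    "'a::{real_inner,banach,second_countable_topology} set \<Rightarrow> ('a \<Rightarrow> 'a) \<Rightarrow> ('a \<Rightarrow> 'a) \<Rightarrow> real \<Rightarrow>
     (real \<Rightarrow> real) \<Rightarrow> 'a \<Rightarrow> (real \<Rightarrow> 'a) \<Rightarrow> bool" where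
  "bilinear_solution D A B T p u0 u \<longleftrightarrow> mild_solution D A T (\<lambda>s. p s *\<^sub>R B (u s)) u0 u"

definition linear_solution ::
    "'a::{real_inner,banach,second_countable_topology} set \<Rightarrow> ('a \<Rightarrow> 'a) \<Rightarrow> ('a \<Rightarrow> 'a) \<Rightarrow> 'a \<Rightarrow>
     real \<Rightarrow> (real \<Rightarrow> real) \<Rightarrow> 'a \<Rightarrow> (real \<Rightarrow> 'a) \<Rightarrow> bool" where
  "linear_solution D A B \<phi>\<^sub>1 T p y0 y \<longleftrightarrow> mild_solution D A T (\<lambda>s. p s *\<^sub>R B \<phi>\<^sub>1) y0 y"

definition null_controls ::
    "'a::{real_inner,banach,second_countable_topology} set \<Rightarrow> ('a \<Rightarrow> 'a) \<Rightarrow> ('a \<Rightarrow> 'a) \<Rightarrow> 'a \<Rightarrow>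
     real \<Rightarrow> 'a \<Rightarrow> (real \<Rightarrow> real) set" where
  "null_controls D A B \<phi>\<^sub>1 T y0 =
     {p. L2_control T p \<and> (\<exists>y. linear_solution D A B \<phi>\<^sub>1 T p y0 y \<and> y T = 0)}"

definition null_controllable1 ::
    "'a::{real_inner,banach,second_countable_topology} set \<Rightarrow> ('a \<Rightarrow> 'a) \<Rightarrow> ('a \<Rightarrow> 'a) \<Rightarrow> 'a \<Rightarrow>
     real \<Rightarrow> bool" where
  "null_controllable1 D A B \<phi>\<^sub>1 T \<longleftrightarrow>
     (\<exists>N>0. \<forall>y0. \<exists>p\<in>null_controls D A B \<phi>\<^sub>1 T y0. L2_norm_control T p \<le> N * norm y0)"

text \<open>
  Real-valued: the infima are over nonempty sets and the supremum is finite exactly when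
  the pair is null controllable, which is assumed wherever the cost is used.
\<close>

definition control_cost ::
    "'a::{real_inner,banach,second_countable_topology} set \<Rightarrow> ('a \<Rightarrow> 'a) \<Rightarrow> ('a \<Rightarrow> 'a) \<Rightarrow> 'a \<Rightarrow>
     real \<Rightarrow> real" where
  "control_cost D A B \<phi>\<^sub>1 T =
     (SUP y0\<in>sphere 0 1. INF p\<in>null_controls D A B \<phi>\<^sub>1 T y0. L2_norm_control T p)"

definition eigensolution :: "real \<Rightarrow> 'a::real_vector \<Rightarrow> real \<Rightarrow> 'a" where
  "eigensolution \<mu> v t = exp (- \<mu> * t) *\<^sub>R v"

definition exactly_controllable_to ::
    "'a::{real_inner,banach,second_countable_topology} set \<Rightarrow> ('a \<Rightarrow> 'a) \<Rightarrow> ('a \<Rightarrow> 'a) \<Rightarrow> 'a \<Rightarrow>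
     (real \<Rightarrow> 'a) \<Rightarrow> real \<Rightarrow> bool" where
  "exactly_controllable_to D A B u0 \<psi> T \<longleftrightarrow>
     (\<exists>p. L2_control T p \<and> (\<exists>u. bilinear_solution D A B T p u0 u \<and> u T = \<psi> T))"

end

theory Submission
  imports Defs
begin

text \<open>
  In the moving frame \<open>w(t) = e\<^sup>\<lambda>\<^sup>t u(t)\<close>, with \<open>\<lambda> = ev 1\<close>, the first eigensolution becomes the rest point
  \<open>e = \<phi> 1\<close> of \<open>w' + (A - \<lambda>) w + p B w = 0\<close>, whose free evolution is a contraction semigroup \<open>S\<close> fixing
  \<open>e\<close>. The task is to steer \<open>w\<close> exactly to \<open>e\<close> in finite time.

  Linearizing at \<open>e\<close> gives the system for which null controls are available at cost \<open>exp (\<nu> / \<tau>)\<close>. If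
  such a control, chosen for the deviation \<open>v = w - e\<close> at the beginning of an interval of length \<open>\<tau>\<close>,
  is applied to the bilinear system, the linear parts cancel at the end and the new deviation is
  only of the order of the square of the cost times \<open>norm v\<close> (\<open>quadratic_step\<close>). Repeating this on
  intervals whose lengths decrease like \<open>(2/3)^n\<close>, the exponents of the cost grow like \<open>(3/2)^n\<close>, more
  slowly than the doubling of the exponent of the deviation; for a small initial deviation the
  scheme converges superexponentially (\<open>step_parameters\<close>) within a finite total time. The controls
  are so small in \<open>L\<^sup>1\<close> that their concatenation has a unique global solution by a contraction
  argument in the supremum norm, and this solution reaches \<open>e\<close> at the accumulation point of the
  intervals (\<open>steering\<close>).

  Large deviations orthogonal to \<open>e\<close> are first left to decay with zero control (\<open>waiting_time\<close>). This
  requires \<open>ev 1 < ev 2\<close>, which is itself a consequence of null controllability: two modes with the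
  same decay rate cannot both be extinguished by one scalar control (\<open>spectral_gap\<close>).

  The semigroup \<open>e\<^sup>-\<^sup>t\<^sup>A\<close> is only given as some strongly continuous semigroup with generator \<open>- A\<close>. That
  there is one and that it acts diagonally on the eigenbasis (\<open>exp_semigroup_diag\<close>) rests on the
  expansion in the basis, on self-adjointness, and on the uniform boundedness principle.
\<close>

section \<open>Expansions in an orthonormal basis\<close>

locale hilbert_basis =
  fixes f :: "nat \<Rightarrow> 'a::{real_inner,banach}"
  assumes inner_basis: "f i \<bullet> f j = (if i = j then 1 else 0)"
    and total: "closure (span (range f)) = UNIV"
begin

lemma orthogonal_basis_zero:
  assumes "\<And>k. x \<bullet> f k = 0"
  shows "x = 0"
proof -
  have "span (range f) \<subseteq> {y. x \<bullet> y = 0}"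
    by (rule span_minimal) (use assms in \<open>auto simp: subspace_def inner_right_distrib\<close>)
  moreover have "closed {y. x \<bullet> y = 0}"
    by (intro closed_Collect_eq continuous_intros)
  ultimately have "x \<in> {y. x \<bullet> y = 0}"
    using closure_minimal total by blast
  then show ?thesis by simp
qed

lemma basis_ext: "(\<And>k. x \<bullet> f k = y \<bullet> f k) \<Longrightarrow> x = y"
  using orthogonal_basis_zero[of "x - y"] by (simp add: inner_diff_left)

lemma inner_sum_basis: "finite I \<Longrightarrow> (\<Sum>k\<in>I. c k *\<^sub>R f k) \<bullet> f j = (if j \<in> I then c j else 0)"
  by (simp add: inner_sum_left inner_basis if_distrib sum.delta cong: if_cong)

lemma norm_sum_basis: "finite I \<Longrightarrow> (norm (\<Sum>k\<in>I. c k *\<^sub>R f k))\<^sup>2 = (\<Sum>k\<in>I. (c k)\<^sup>2)"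
  unfolding power2_norm_eq_inner
  by (subst inner_sum_right) (auto simp: inner_sum_basis power2_eq_square intro!: sum.cong)

lemma summable_coord_square: "summable (\<lambda>k. (x \<bullet> f k)\<^sup>2)"
proof (rule summableI_nonneg_bounded)
  fix n
  let ?s = "\<Sum>k<n. (x \<bullet> f k) *\<^sub>R f k"
  have "x \<bullet> ?s = (\<Sum>k<n. (x \<bullet> f k)\<^sup>2)"
    by (simp add: inner_sum_right power2_eq_square)
  moreover have "?s \<bullet> ?s = (\<Sum>k<n. (x \<bullet> f k)\<^sup>2)"
    using norm_sum_basis[of "{..<n}" "\<lambda>k. x \<bullet> f k"] by (simp add: power2_norm_eq_inner)
  moreover have "0 \<le> (x - ?s) \<bullet> (x - ?s)" by simp
  ultimately show "(\<Sum>k<n. (x \<bullet> f k)\<^sup>2) \<le> x \<bullet> x"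
    by (simp add: inner_diff_left inner_diff_right inner_commute)
qed simp

lemma summable_basis:
  assumes "summable (\<lambda>k. (c k)\<^sup>2)"
  shows "summable (\<lambda>k. c k *\<^sub>R f k)"
  unfolding summable_Cauchy
proof (intro allI impI)
  fix e :: real assume "e > 0"
  then obtain N where N: "\<And>m n. m \<ge> N \<Longrightarrow> norm (\<Sum>k=m..<n. (c k)\<^sup>2) < e\<^sup>2"
    using assms unfolding summable_Cauchy by (meson zero_less_power)
  have "norm (\<Sum>k=m..<n. c k *\<^sub>R f k) < e" if "m \<ge> N" for m n
  proof (rule power2_less_imp_less)
    show "(norm (\<Sum>k=m..<n. c k *\<^sub>R f k))\<^sup>2 < e\<^sup>2"
      using N[OF that, of n] by (simp add: norm_sum_basis sum_nonneg)
  qed (use \<open>e > 0\<close> in simp)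
  then show "\<exists>N. \<forall>m\<ge>N. \<forall>n. norm (sum (\<lambda>k. c k *\<^sub>R f k) {m..<n}) < e" by blast
qed

lemma inner_suminf_basis:
  assumes "summable (\<lambda>k. (c k)\<^sup>2)"
  shows "(\<Sum>k. c k *\<^sub>R f k) \<bullet> f j = c j"
proof -
  have "(\<lambda>k. (c k *\<^sub>R f k) \<bullet> f j) sums ((\<Sum>k. c k *\<^sub>R f k) \<bullet> f j)"
    by (intro bounded_linear.sums[OF bounded_linear_inner_left] summable_sums summable_basis assms)
  moreover have "(\<lambda>k. (c k *\<^sub>R f k) \<bullet> f j) sums c j"
    using sums_single[of j c] by (simp add: inner_basis if_distrib cong: if_cong)
  ultimately show ?thesis by (rule sums_unique2)
qed

lemma sums_basis: "(\<lambda>k. (x \<bullet> f k) *\<^sub>R f k) sums x"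
proof -
  have "(\<Sum>k. (x \<bullet> f k) *\<^sub>R f k) = x"
    by (rule basis_ext) (simp add: inner_suminf_basis summable_coord_square)
  then show ?thesis using summable_basis[OF summable_coord_square[of x]] summable_sums by metis
qed

lemma sums_inner: "(\<lambda>k. (x \<bullet> f k) * (y \<bullet> f k)) sums (x \<bullet> y)"
  using bounded_linear.sums[OF bounded_linear_inner_left sums_basis, of x y]
  by (simp add: inner_commute)

lemma sums_norm_square: "(\<lambda>k. (x \<bullet> f k)\<^sup>2) sums (norm x)\<^sup>2"
  using sums_inner[of x x] by (simp add: power2_eq_square power2_norm_eq_inner[symmetric])

lemma norm_le_coord:
  assumes "\<And>k. \<bar>x \<bullet> f k\<bar> \<le> c * \<bar>y \<bullet> f k\<bar>" and "c \<ge> 0"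
  shows "norm x \<le> c * norm y"
proof (rule power2_le_imp_le)
  have "(norm x)\<^sup>2 \<le> c\<^sup>2 * (norm y)\<^sup>2"
  proof (rule sums_le[OF _ sums_norm_square])
    show "(\<lambda>k. c\<^sup>2 * (y \<bullet> f k)\<^sup>2) sums (c\<^sup>2 * (norm y)\<^sup>2)"
      by (intro sums_mult sums_norm_square)
    show "(x \<bullet> f k)\<^sup>2 \<le> c\<^sup>2 * (y \<bullet> f k)\<^sup>2" for k
      using power_mono[OF assms(1)[of k], of 2] by (simp add: power_mult_distrib)
  qed
  then show "(norm x)\<^sup>2 \<le> (c * norm y)\<^sup>2" by (simp add: power_mult_distrib)
qed (use assms in simp)

text \<open>
  Dominated convergence for coordinates: the squared norm is the sum of the squared coordinates,
  so coordinatewise convergence under a fixed square-summable majorant passes to the norm.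
\<close>

lemma tendsto_zero_coord:
  fixes z :: "'b \<Rightarrow> 'a"
  assumes lim: "\<And>k. ((\<lambda>h. z h \<bullet> f k) \<longlongrightarrow> 0) F"
    and dom: "eventually (\<lambda>h. \<forall>k. \<bar>z h \<bullet> f k\<bar> \<le> \<bar>w \<bullet> f k\<bar>) F"
    and "F \<noteq> bot"
  shows "(z \<longlongrightarrow> 0) F"
proof -
  have "((\<lambda>h. \<Sum>k. (z h \<bullet> f k)\<^sup>2) \<longlongrightarrow> (\<Sum>k. (0::real))) F"
  proof (rule conjunct2[OF conjunct2[OF tannerys_theorem]])
    show "((\<lambda>h. (z h \<bullet> f k)\<^sup>2) \<longlongrightarrow> 0) F" for k
      using tendsto_power[OF lim[of k], of 2] by simp
    have "eventually (\<lambda>(k,h). \<forall>k. \<bar>z h \<bullet> f k\<bar> \<le> \<bar>w \<bullet> f k\<bar>) (at_top \<times>\<^sub>F F)"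
      using eventually_prodI[of "\<lambda>_. True", OF _ dom] by (simp add: case_prod_beta')
    then show "eventually (\<lambda>(k,h). norm ((z h \<bullet> f k)\<^sup>2) \<le> (w \<bullet> f k)\<^sup>2) (at_top \<times>\<^sub>F F)"
      by eventually_elim (auto simp: abs_le_square_iff)
  qed (use assms summable_coord_square in auto)
  then have "((\<lambda>h. (norm (z h))\<^sup>2) \<longlongrightarrow> 0) F"
    using sums_norm_square[THEN sums_unique] by simp
  then have "((\<lambda>h. sqrt ((norm (z h))\<^sup>2)) \<longlongrightarrow> sqrt 0) F" by (rule tendsto_real_sqrt)
  then show ?thesis by (simp add: tendsto_norm_zero_iff)
qed

section \<open>Diagonal semigroups\<close>

definition diag_semigroup :: "(nat \<Rightarrow> real) \<Rightarrow> real \<Rightarrow> 'a \<Rightarrow> 'a" where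
  "diag_semigroup \<mu> t x = (\<Sum>k. (exp (- \<mu> k * t) * (x \<bullet> f k)) *\<^sub>R f k)"

context
  fixes \<mu> :: "nat \<Rightarrow> real"
  assumes \<mu>_nonneg: "\<mu> k \<ge> 0"
begin

lemma exp_coord_le: "t \<ge> 0 \<Longrightarrow> exp (- \<mu> k * t) \<le> 1"
  using \<mu>_nonneg[of k] by simp

lemma inner_diag:
  assumes "t \<ge> 0"
  shows "diag_semigroup \<mu> t x \<bullet> f k = exp (- \<mu> k * t) * (x \<bullet> f k)"
  unfolding diag_semigroup_def
proof (rule inner_suminf_basis)
  show "summable (\<lambda>k. (exp (- \<mu> k * t) * (x \<bullet> f k))\<^sup>2)"
  proof (rule summable_comparison_test'[OF summable_coord_square])
    fix k
    have "(exp (- \<mu> k * t))\<^sup>2 \<le> 1"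
      using exp_coord_le[OF assms, of k] by (simp add: power_le_one)
    then show "norm ((exp (- \<mu> k * t) * (x \<bullet> f k))\<^sup>2) \<le> (x \<bullet> f k)\<^sup>2"
      unfolding power_mult_distrib real_norm_def by (simp add: mult_left_le_one_le)
  qed
qed

lemma norm_diag: "t \<ge> 0 \<Longrightarrow> norm (diag_semigroup \<mu> t x) \<le> norm x"
  using norm_le_coord[of "diag_semigroup \<mu> t x" 1 x] exp_coord_le
  by (simp add: inner_diag abs_mult mult_left_le_one_le)

lemma bounded_linear_diag: "t \<ge> 0 \<Longrightarrow> bounded_linear (diag_semigroup \<mu> t)"
  by (rule bounded_linear_intro[where K = 1])
    (auto intro!: basis_ext simp: inner_diag inner_add_left algebra_simps norm_diag)

lemma diag_0: "diag_semigroup \<mu> 0 x = x"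
  by (rule basis_ext) (simp add: inner_diag)

lemma diag_add:
  "s \<ge> 0 \<Longrightarrow> t \<ge> 0 \<Longrightarrow> diag_semigroup \<mu> (s + t) x = diag_semigroup \<mu> s (diag_semigroup \<mu> t x)"
  by (rule basis_ext) (simp add: inner_diag algebra_simps exp_add[symmetric])

lemma continuous_diag: "continuous_on {0..} (\<lambda>t. diag_semigroup \<mu> t x)"
  unfolding continuous_on_def
proof
  fix t :: real assume t: "t \<in> {0..}"
  have "((\<lambda>s. diag_semigroup \<mu> s x - diag_semigroup \<mu> t x) \<longlongrightarrow> 0) (at t within {0..})"
  proof (rule tendsto_zero_coord[where w = x])
    have ev: "eventually (\<lambda>s. s \<ge> 0) (at t within {0..})"
      by (simp add: eventually_at_filter)
    have coord: "(diag_semigroup \<mu> s x - diag_semigroup \<mu> t x) \<bullet> f k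
        = (exp (- \<mu> k * s) - exp (- \<mu> k * t)) * (x \<bullet> f k)" if "s \<ge> 0" for s k
      using that t by (simp add: inner_diag inner_diff_left algebra_simps)
    show "((\<lambda>s. (diag_semigroup \<mu> s x - diag_semigroup \<mu> t x) \<bullet> f k) \<longlongrightarrow> 0) (at t within {0..})" for k
    proof (rule Lim_transform_eventually)
      show "((\<lambda>s. (exp (- \<mu> k * s) - exp (- \<mu> k * t)) * (x \<bullet> f k)) \<longlongrightarrow> 0) (at t within {0..})"
        by (auto intro!: tendsto_eq_intros)
      show "eventually (\<lambda>s. (exp (- \<mu> k * s) - exp (- \<mu> k * t)) * (x \<bullet> f k)
          = (diag_semigroup \<mu> s x - diag_semigroup \<mu> t x) \<bullet> f k) (at t within {0..})"
        using ev by eventually_elim (simp only: coord)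
    qed
    show "eventually (\<lambda>s. \<forall>k. \<bar>(diag_semigroup \<mu> s x - diag_semigroup \<mu> t x) \<bullet> f k\<bar> \<le> \<bar>x \<bullet> f k\<bar>) (at t within {0..})"
      using ev
    proof (eventually_elim, intro allI)
      fix s k assume s: "(s::real) \<ge> 0"
      have "\<bar>exp (- \<mu> k * s) - exp (- \<mu> k * t)\<bar> \<le> 1"
        using exp_coord_le[OF s, of k] exp_coord_le[of t k] t exp_gt_zero[of "- \<mu> k * s"]
          exp_gt_zero[of "- \<mu> k * t"] by (auto simp: abs_le_iff simp del: exp_gt_zero exp_le_one_iff)
      then show "\<bar>(diag_semigroup \<mu> s x - diag_semigroup \<mu> t x) \<bullet> f k\<bar> \<le> \<bar>x \<bullet> f k\<bar>"
        unfolding coord[OF s] abs_mult by (simp add: mult_left_le_one_le)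
    qed
    show "at t within {0..} \<noteq> bot"
    proof -
      have "at_right t \<le> at t within {0..}"
        using t by (intro at_le) auto
      then show ?thesis
        using trivial_limit_at_right_real[of t] by (metis bot.extremum_uniqueI)
    qed
  qed
  then show "((\<lambda>s. diag_semigroup \<mu> s x) \<longlongrightarrow> diag_semigroup \<mu> t x) (at t within {0..})"
    by (simp add: LIM_zero_iff)
qed

lemma c0_diag: "c0_semigroup (diag_semigroup \<mu>)"
proof -
  have "((\<lambda>t. diag_semigroup \<mu> t x) \<longlongrightarrow> x) (at_right 0)" for x
    using continuous_diag[of x, unfolded continuous_on_def, rule_format, of 0]
    by (simp add: diag_0) (rule tendsto_within_subset, auto)
  then show ?thesis
    unfolding c0_semigroup_def using bounded_linear_diag diag_0 diag_add by blast
qed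

end

end

section \<open>Uniqueness of the semigroup with a given generator\<close>

text \<open>Baire: one of the closed sets on which the family is bounded by a natural number contains a ball.\<close>

lemma uniform_boundedness:
  fixes T :: "'i \<Rightarrow> 'a::banach \<Rightarrow> 'b::real_normed_vector"
  assumes lin: "\<And>i. i \<in> I \<Longrightarrow> bounded_linear (T i)"
    and ptw: "\<And>x. \<exists>c. \<forall>i\<in>I. norm (T i x) \<le> c"
  shows "\<exists>M. \<forall>i\<in>I. \<forall>x. norm (T i x) \<le> M * norm x"
proof -
  define F where "F n = {x. \<forall>i\<in>I. norm (T i x) \<le> real n}" for n :: nat
  have closed: "closed (F n)" for n
  proof -
    have "F n = (\<Inter>i\<in>I. {x. norm (T i x) \<le> real n})" by (auto simp: F_def)
    then show ?thesis
      using lin by (auto intro!: closed_INT closed_Collect_le continuous_intros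
        simp: linear_continuous_on)
  qed
  have cover: "(\<Union>n. F n) = UNIV"
  proof (intro set_eqI iffI UNIV_I)
    fix x
    obtain c where c: "\<forall>i\<in>I. norm (T i x) \<le> c" using ptw by blast
    obtain n where "c \<le> real n" using real_arch_simple by blast
    then have "x \<in> F n" using c unfolding F_def by (auto intro: order_trans)
    then show "x \<in> (\<Union>n. F n)" by blast
  qed
  have "\<exists>n. interior (F n) \<noteq> {}"
  proof (rule ccontr)
    assume "\<not> (\<exists>n. interior (F n) \<noteq> {})"
    then have "Met_TC.mtopology interior_of (\<Union>(range F)) = ({}::'a set)"
      using closed by (intro Met_TC.metric_Baire_category_alt)
        (auto simp: mcomplete_iff_complete complete_UNIV)
    then show False by (simp add: cover)
  qed
  then obtain n a r where r: "r > 0" "ball a r \<subseteq> F n"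
    by (meson equals0I mem_interior)
  have "norm (T i x) \<le> (4 * real n / r) * norm x" if i: "i \<in> I" for i x
  proof (cases "x = 0")
    case True
    then show ?thesis using lin[OF i] by (simp add: linear_0 bounded_linear.linear)
  next
    case False
    define c where "c = r / 2 / norm x"
    have c: "c > 0" using r False by (simp add: c_def)
    have "a + c *\<^sub>R x \<in> F n" "a \<in> F n"
      using r False by (auto simp: c_def dist_norm intro!: subsetD[OF r(2)])
    then have "norm (T i (a + c *\<^sub>R x) - T i a) \<le> real n + real n"
      using i by (intro norm_triangle_le_diff add_mono) (auto simp: F_def)
    also have "T i (a + c *\<^sub>R x) - T i a = c *\<^sub>R T i x"
      using lin[OF i] by (simp add: linear_add linear_scale bounded_linear.linear)
    finally have "norm (T i x) \<le> 2 * real n / c"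
      using c by (simp add: field_simps)
    then show ?thesis by (simp add: c_def field_simps)
  qed
  then show ?thesis by blast
qed

text \<open>
  Otherwise there are times \<open>t n\<close> tending to 0 along which the operator norms are unbounded, although
  \<open>S (t n) x\<close> converges for every \<open>x\<close>.
\<close>

lemma c0_semigroup_bounded_near_zero:
  fixes S :: "real \<Rightarrow> 'a::banach \<Rightarrow> 'a"
  assumes "c0_semigroup S"
  shows "\<exists>\<delta>>0. \<exists>M. \<forall>t\<in>{0..\<delta>}. \<forall>x. norm (S t x) \<le> M * norm x"
proof (rule ccontr)
  note S = assms[unfolded c0_semigroup_def]
  assume "\<not> ?thesis"
  then have "\<exists>t\<in>{0..\<delta>}. \<exists>x. norm (S t x) > M * norm x" if "\<delta> > 0" for \<delta> M
    using that by (meson not_less)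
  then have "\<exists>t\<in>{0..inverse (Suc n)}. \<exists>x. norm (S t x) > real n * norm x" for n
    by simp
  then obtain t where t: "\<And>n. t n \<in> {0..inverse (real (Suc n))}"
    and ex: "\<And>n. \<exists>x. norm (S (t n) x) > real n * norm x"
    by metis
  have "\<exists>c. \<forall>n\<in>UNIV. norm (S (t n) x) \<le> c" for x
  proof -
    have "(\<lambda>n. S (t n) x) \<longlonglongrightarrow> x"
    proof (rule metric_LIMSEQ_I)
      fix e :: real assume e: "e > 0"
      have "eventually (\<lambda>t. dist (S t x) x < e) (at_right 0)"
        using S e tendstoD by blast
      then obtain d where d: "d > 0" "\<And>s. 0 < s \<Longrightarrow> s < d \<Longrightarrow> dist (S s x) x < e"
        unfolding eventually_at_right_field by auto
      obtain N where N: "inverse (real (Suc N)) < d" using reals_Archimedean[OF d(1)] by blast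
      have "dist (S (t n) x) x < e" if "n \<ge> N" for n
      proof (cases "t n = 0")
        case True then show ?thesis using S e by simp
      next
        case False
        have le: "inverse (real (Suc n)) \<le> inverse (real (Suc N))" using that by simp
        have "t n \<le> inverse (real (Suc n))" "0 \<le> t n" using t[of n] by auto
        then have "t n < d" "0 < t n" using le N False by linarith+
        then show ?thesis using d(2) by blast
      qed
      then show "\<exists>N. \<forall>n\<ge>N. dist (S (t n) x) x < e" by blast
    qed
    then have "Bseq (\<lambda>n. S (t n) x)" by (intro convergent_imp_Bseq convergentI)
    then show ?thesis by (auto simp: Bseq_def)
  qed
  moreover have "bounded_linear (S (t n))" for n using S t[of n] by simp
  ultimately obtain M where M: "\<And>n x. norm (S (t n) x) \<le> M * norm x"
    using uniform_boundedness[of UNIV "\<lambda>n. S (t n)"] by auto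
  obtain n where n: "M \<le> real n" using real_arch_simple by blast
  obtain x where "real n * norm x < norm (S (t n) x)" using ex by blast
  also have "\<dots> \<le> M * norm x" by (rule M)
  also have "\<dots> \<le> real n * norm x" using n by (simp add: mult_right_mono)
  finally show False by simp
qed

text \<open>
  Splitting \<open>V t x - x\<close> into \<open>n\<close> increments over time \<open>t/n\<close> bounds it by a multiple of the difference
  quotient at \<open>t/n\<close>, which tends to zero. Boundedness of \<open>V\<close> near zero makes the multiple independent
  of \<open>n\<close>, for small \<open>t\<close>; the semigroup law extends the result to all \<open>t\<close>.
\<close>

lemma c0_semigroup_fixes:
  fixes V :: "real \<Rightarrow> 'a::banach \<Rightarrow> 'a"
  assumes V: "c0_semigroup V"
    and gen: "((\<lambda>h. (V h x - x) /\<^sub>R h) \<longlongrightarrow> 0) (at_right 0)"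
    and "t \<ge> 0"
  shows "V t x = x"
proof -
  note V' = V[unfolded c0_semigroup_def]
  obtain \<delta> M0 where \<delta>: "\<delta> > 0" and M0: "\<And>t x. t \<in> {0..\<delta>} \<Longrightarrow> norm (V t x) \<le> M0 * norm x"
    using c0_semigroup_bounded_near_zero[OF V] by blast
  define M where "M = max M0 0"
  have M: "norm (V t x) \<le> M * norm x" if "t \<in> {0..\<delta>}" for t x
    using M0[OF that, of x] by (smt (verit) M_def mult_right_mono norm_ge_zero)
  have tele: "norm (V (real n * h) x - x) \<le> real n * (M * norm (V h x - x))"
    if h: "h \<ge> 0" and nh: "real n * h \<le> \<delta>" for n h
    using nh
  proof (induction n)
    case 0
    then show ?case using V' by simp
  next
    case (Suc n)
    have le: "real n * h \<le> \<delta>" using Suc.prems h by (simp add: algebra_simps)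
    have eq: "V (real (Suc n) * h) x = V (real n * h) (V h x)"
      using V'[THEN conjunct2, THEN conjunct2, THEN conjunct1, rule_format, of "real n * h" h x] h
      by (simp add: algebra_simps)
    have "V (real (Suc n) * h) x - x = V (real n * h) (V h x - x) + (V (real n * h) x - x)"
      using V' h unfolding eq by (simp add: bounded_linear.linear linear_diff)
    also have "norm \<dots> \<le> M * norm (V h x - x) + real n * (M * norm (V h x - x))"
      using h le Suc.IH by (intro norm_triangle_mono M) auto
    finally show ?case by (simp add: algebra_simps)
  qed
  have small: "V s x = x" if s: "0 < s" "s \<le> \<delta>" for s
  proof -
    define h where "h n = s / real (Suc n)" for n
    have "h \<longlonglongrightarrow> 0"
      unfolding h_def by (rule LIMSEQ_Suc[OF lim_const_over_n])
    then have "filterlim h (at_right 0) sequentially"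
      using s by (auto simp: filterlim_at h_def)
    then have "(\<lambda>n. (V (h n) x - x) /\<^sub>R h n) \<longlonglongrightarrow> 0"
      by (rule filterlim_compose[OF gen])
    then have "(\<lambda>n. (M * s) * norm ((V (h n) x - x) /\<^sub>R h n)) \<longlonglongrightarrow> 0"
      using tendsto_mult_right_zero tendsto_norm_zero by blast
    moreover have "norm (V s x - x) \<le> (M * s) * norm ((V (h n) x - x) /\<^sub>R h n)" for n
    proof -
      have hn: "real (Suc n) * h n = s" "h n > 0" using s by (simp_all add: h_def)
      have "norm ((V (h n) x - x) /\<^sub>R h n) = norm (V (h n) x - x) / h n"
        using hn(2) by (simp add: divide_inverse)
      moreover have "norm (V s x - x) \<le> real (Suc n) * (M * norm (V (h n) x - x))"
        using tele[of "h n" "Suc n"] s hn by simp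
      moreover have "real (Suc n) = s / h n" using hn by (simp add: field_simps)
      ultimately show ?thesis by (simp only:) (simp add: field_simps)
    qed
    ultimately have "norm (V s x - x) \<le> 0"
      by (intro LIMSEQ_le_const) auto
    then show ?thesis by simp
  qed
  obtain n where n: "t / \<delta> < real n" using reals_Archimedean2 by blast
  have "n > 0" using n \<delta> \<open>t \<ge> 0\<close> by (metis divide_nonneg_pos gr0I linorder_not_less of_nat_0)
  show ?thesis
  proof (cases "t = 0")
    case False
    define s where "s = t / real n"
    have s: "0 < s" "s \<le> \<delta>"
      using n \<delta> \<open>t \<ge> 0\<close> \<open>n > 0\<close> False by (auto simp: s_def field_simps)
    have "V (real k * s) x = x" for k
    proof (induction k)
      case (Suc k)
      have "V (real (Suc k) * s) x = V s (V (real k * s) x)"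
        using V'[THEN conjunct2, THEN conjunct2, THEN conjunct1, rule_format, of s "real k * s" x] s
        by (simp add: algebra_simps)
      then show ?case using Suc small[OF s] by simp
    qed (use V' in simp)
    from this[of n] show ?thesis using \<open>n > 0\<close> by (simp add: s_def)
  qed (use V' in simp)
qed

lemma tendsto_exp_quotient: "((\<lambda>h. (exp (c * h) - 1) / h) \<longlongrightarrow> c) (at_right (0::real))"
proof -
  have "((\<lambda>h. exp (c * h)) has_field_derivative c) (at 0)"
    by (auto intro!: derivative_eq_intros)
  then show ?thesis
    by (auto simp: DERIV_def intro: tendsto_within_subset)
qed

text \<open>The rescaled semigroup \<open>exp (\<mu> * t) *\<^sub>R S t\<close> has derivative zero at \<open>v\<close>, hence fixes \<open>v\<close>.\<close>

lemma semigroup_eigenvector: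
  fixes S :: "real \<Rightarrow> 'a::banach \<Rightarrow> 'a"
  assumes S: "c0_semigroup S" and gen: "has_generator S D (\<lambda>x. - A x)"
    and v: "v \<in> D" "A v = \<mu> *\<^sub>R v" and "t \<ge> 0"
  shows "S t v = exp (- \<mu> * t) *\<^sub>R v"
proof -
  note S' = S[unfolded c0_semigroup_def]
  define V where "V t x = exp (\<mu> * t) *\<^sub>R S t x" for t x
  have "c0_semigroup V"
    unfolding c0_semigroup_def
  proof (intro conjI allI impI)
    show "bounded_linear (V t)" if "t \<ge> 0" for t
      unfolding V_def using S' that by (intro bounded_linear_const_scaleR) auto
    show "V 0 x = x" for x using S' by (simp add: V_def)
    show "V (s + t) x = V s (V t x)" if "s \<ge> 0" "t \<ge> 0" for s t x
      using S' that by (simp add: V_def distrib_left exp_add bounded_linear.linear linear_scale)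
    show "((\<lambda>t. V t x) \<longlongrightarrow> x) (at_right 0)" for x
      unfolding V_def using S' by (auto intro!: tendsto_eq_intros)
  qed
  moreover have "((\<lambda>h. (V h v - v) /\<^sub>R h) \<longlongrightarrow> 0) (at_right 0)"
  proof -
    have "((\<lambda>h. (S h v - v) /\<^sub>R h) \<longlongrightarrow> - \<mu> *\<^sub>R v) (at_right 0)"
      using gen v(1) unfolding has_generator_def v(2)[symmetric] by (metis scaleR_minus_left v(2))
    then have "((\<lambda>h. exp (\<mu> * h) *\<^sub>R ((S h v - v) /\<^sub>R h)) \<longlongrightarrow> exp (\<mu> * 0) *\<^sub>R (- \<mu> *\<^sub>R v)) (at_right 0)"
      by (rule tendsto_scaleR[rotated]) (intro tendsto_intros)
    moreover have "((\<lambda>h. ((exp (\<mu> * h) - 1) / h) *\<^sub>R v) \<longlongrightarrow> \<mu> *\<^sub>R v) (at_right 0)"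
      by (rule tendsto_scaleR[OF tendsto_exp_quotient tendsto_const])
    ultimately have "((\<lambda>h. exp (\<mu> * h) *\<^sub>R ((S h v - v) /\<^sub>R h) + ((exp (\<mu> * h) - 1) / h) *\<^sub>R v)
        \<longlongrightarrow> exp (\<mu> * 0) *\<^sub>R (- \<mu> *\<^sub>R v) + \<mu> *\<^sub>R v) (at_right 0)"
      by (rule tendsto_add)
    moreover have "exp (\<mu> * h) *\<^sub>R ((S h v - v) /\<^sub>R h) + ((exp (\<mu> * h) - 1) / h) *\<^sub>R v
        = (V h v - v) /\<^sub>R h" for h
      by (simp add: V_def algebra_simps divide_inverse)
    ultimately show ?thesis by simp
  qed
  ultimately have "V t v = v"
    using \<open>t \<ge> 0\<close> by (intro c0_semigroup_fixes) auto
  then have "exp (- \<mu> * t) *\<^sub>R v = exp (- \<mu> * t) *\<^sub>R exp (\<mu> * t) *\<^sub>R S t v" by (simp add: V_def)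
  also have "\<dots> = S t v" by (simp add: exp_add[symmetric])
  finally show ?thesis by simp
qed

lemma dense_inner_eq:
  fixes D :: "'a::real_inner set"
  assumes "closure D = UNIV" and "\<And>x. x \<in> D \<Longrightarrow> x \<bullet> y = x \<bullet> z"
  shows "y = z"
proof -
  have "closed {x. x \<bullet> y = x \<bullet> z}" by (intro closed_Collect_eq continuous_intros)
  then have "closure D \<subseteq> {x. x \<bullet> y = x \<bullet> z}" using assms(2) by (intro closure_minimal) auto
  then have "(y - z) \<bullet> y = (y - z) \<bullet> z" using assms(1) by blast
  then have "(y - z) \<bullet> (y - z) = 0" by (simp add: inner_diff_right)
  then show ?thesis by simp
qed

lemma self_adjoint_symmetric:
  assumes "densely_defined_linear D A" and sa: "self_adjoint D A" and "x \<in> D" "y \<in> D"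
  shows "A x \<bullet> y = x \<bullet> A y"
proof -
  have dense: "closure D = UNIV" using assms by (simp add: densely_defined_linear_def)
  have "y \<in> adjoint_dom D A" using assms by (simp add: self_adjoint_def)
  then obtain z where z: "\<forall>x\<in>D. A x \<bullet> y = x \<bullet> z" by (auto simp: adjoint_dom_def)
  have "adjoint_op D A y = z"
    unfolding adjoint_op_def
  proof (rule the_equality)
    show "w = z" if "\<forall>x\<in>D. A x \<bullet> y = x \<bullet> w" for w
      by (rule dense_inner_eq[OF dense]) (use that z in simp)
  qed (rule z)
  then show ?thesis using sa z assms by (auto simp: self_adjoint_def)
qed

context hilbert_basis
begin

text \<open>
  On \<open>D\<close> the coordinates of the difference quotients are dominated by those of \<open>A x\<close>, because
  \<open>0 \<le> (1 - exp (- \<mu> h)) / h \<le> \<mu>\<close>. That the domain of the generator is no larger than \<open>D\<close> uses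
  self-adjointness beyond symmetry: \<open>D\<close> contains the domain of the adjoint.
\<close>

lemma diag_generator:
  assumes dd: "densely_defined_linear D A" and sa: "self_adjoint D A"
    and \<mu>: "\<And>k. \<mu> k \<ge> 0" and eig: "\<And>k. f k \<in> D" "\<And>k. A (f k) = \<mu> k *\<^sub>R f k"
  shows "has_generator (diag_semigroup \<mu>) D (\<lambda>x. - A x)"
proof -
  note inner_diag = inner_diag[OF \<mu>]
  have coord: "A x \<bullet> f k = \<mu> k * (x \<bullet> f k)" if "x \<in> D" for x k
    using self_adjoint_symmetric[OF dd sa that eig(1)[of k]] by (simp add: eig(2))
  have quot: "((diag_semigroup \<mu> h x - x) /\<^sub>R h) \<bullet> f k = ((exp (- \<mu> k * h) - 1) / h) * (x \<bullet> f k)"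
    if "h > 0" for h x k
    using that by (simp add: inner_diag inner_diff_left divide_inverse algebra_simps)
  have lim_coord: "((\<lambda>h. ((diag_semigroup \<mu> h x - x) /\<^sub>R h) \<bullet> f k) \<longlongrightarrow> - \<mu> k * (x \<bullet> f k)) (at_right 0)" for x k
  proof (rule Lim_transform_eventually)
    show "((\<lambda>h. ((exp (- \<mu> k * h) - 1) / h) * (x \<bullet> f k)) \<longlongrightarrow> - \<mu> k * (x \<bullet> f k)) (at_right 0)"
      by (intro tendsto_intros tendsto_exp_quotient)
    show "\<forall>\<^sub>F h in at_right 0. ((exp (- \<mu> k * h) - 1) / h) * (x \<bullet> f k)
        = ((diag_semigroup \<mu> h x - x) /\<^sub>R h) \<bullet> f k"
      using eventually_at_right_less[of 0] by eventually_elim (simp only: quot)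
  qed
  have lim: "((\<lambda>h. (diag_semigroup \<mu> h x - x) /\<^sub>R h) \<longlongrightarrow> - A x) (at_right 0)" if x: "x \<in> D" for x
  proof -
    have "((\<lambda>h. (diag_semigroup \<mu> h x - x) /\<^sub>R h - - A x) \<longlongrightarrow> 0) (at_right 0)"
    proof (rule tendsto_zero_coord[where w = "A x"])
      show "((\<lambda>h. ((diag_semigroup \<mu> h x - x) /\<^sub>R h - - A x) \<bullet> f k) \<longlongrightarrow> 0) (at_right 0)" for k
        using tendsto_add[OF lim_coord[of x k] tendsto_const[of "\<mu> k * (x \<bullet> f k)"]]
        by (simp add: inner_add_left coord[OF x])
      show "\<forall>\<^sub>F h in at_right 0. \<forall>k. \<bar>((diag_semigroup \<mu> h x - x) /\<^sub>R h - - A x) \<bullet> f k\<bar> \<le> \<bar>A x \<bullet> f k\<bar>"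
        using eventually_at_right_less[of 0]
      proof (eventually_elim, intro allI)
        fix h :: real and k assume h: "0 < h"
        have "((diag_semigroup \<mu> h x - x) /\<^sub>R h - - A x) \<bullet> f k
            = ((exp (- \<mu> k * h) - 1) / h + \<mu> k) * (x \<bullet> f k)"
          using quot[OF h, of x k] by (simp add: inner_add_left coord[OF x] algebra_simps)
        moreover have "\<bar>(exp (- \<mu> k * h) - 1) / h + \<mu> k\<bar> \<le> \<mu> k"
        proof -
          have "1 - \<mu> k * h \<le> exp (- \<mu> k * h)" using exp_ge_add_one_self[of "- \<mu> k * h"] by simp
          moreover have "exp (- \<mu> k * h) \<le> 1" using \<mu>[of k] h by simp
          ultimately have "- \<mu> k \<le> (exp (- \<mu> k * h) - 1) / h" "(exp (- \<mu> k * h) - 1) / h \<le> 0"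
            using h by (auto simp: field_simps)
          then show ?thesis by linarith
        qed
        ultimately show "\<bar>((diag_semigroup \<mu> h x - x) /\<^sub>R h - - A x) \<bullet> f k\<bar> \<le> \<bar>A x \<bullet> f k\<bar>"
          using \<mu>[of k] by (simp add: coord[OF x] abs_mult mult_right_mono)
      qed
    qed simp
    then show ?thesis by (simp only: LIM_zero_iff)
  qed
  \<comment> \<open>A vector with convergent difference quotients lies in the domain of the adjoint.\<close>
  have "x \<in> D" if y: "((\<lambda>h. (diag_semigroup \<mu> h x - x) /\<^sub>R h) \<longlongrightarrow> y) (at_right 0)" for x y
  proof -
    have yk: "y \<bullet> f k = - \<mu> k * (x \<bullet> f k)" for k
      using tendsto_unique[OF _ tendsto_inner[OF y tendsto_const] lim_coord] by simp
    have "A z \<bullet> x = z \<bullet> (- y)" if z: "z \<in> D" for z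
      using sums_unique2[OF sums_inner[of "A z" x]] sums_inner[of z "- y"]
      by (simp add: coord[OF z] yk algebra_simps)
    then have "x \<in> adjoint_dom D A" unfolding adjoint_dom_def by blast
    then show ?thesis using sa by (simp add: self_adjoint_def)
  qed
  then show ?thesis unfolding has_generator_def using lim by blast
qed

text \<open>
  The diagonal semigroup witnesses that the choice has a candidate, and whichever semigroup is
  chosen agrees with it on the eigenvectors, which are total.
\<close>

lemma exp_semigroup_diag:
  assumes dd: "densely_defined_linear D A" and sa: "self_adjoint D A"
    and \<mu>: "\<And>k. \<mu> k \<ge> 0" and eig: "\<And>k. f k \<in> D" "\<And>k. A (f k) = \<mu> k *\<^sub>R f k"
    and t: "t \<ge> 0"
  shows "exp_semigroup D A t x = diag_semigroup \<mu> t x"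
proof -
  have "c0_semigroup (diag_semigroup \<mu>)" by (rule c0_diag) (rule \<mu>)
  moreover have "has_generator (diag_semigroup \<mu>) D (\<lambda>x. - A x)"
    by (rule diag_generator) fact+
  ultimately have "c0_semigroup (exp_semigroup D A) \<and> has_generator (exp_semigroup D A) D (\<lambda>x. - A x)"
    unfolding exp_semigroup_def
    by - (rule someI[of "\<lambda>S. c0_semigroup S \<and> has_generator S D (\<lambda>x. - A x)" "diag_semigroup \<mu>"], blast)
  then have S: "c0_semigroup (exp_semigroup D A)" "has_generator (exp_semigroup D A) D (\<lambda>x. - A x)"
    by auto
  have bl: "bounded_linear (exp_semigroup D A t)" using S t by (simp add: c0_semigroup_def)
  have "(\<lambda>k. exp_semigroup D A t ((x \<bullet> f k) *\<^sub>R f k)) sums exp_semigroup D A t x"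
    by (rule bounded_linear.sums[OF bl sums_basis])
  moreover have "exp_semigroup D A t ((x \<bullet> f k) *\<^sub>R f k) = (exp (- \<mu> k * t) * (x \<bullet> f k)) *\<^sub>R f k" for k
    using semigroup_eigenvector[OF S eig(1) eig(2) t] bl
    by (simp add: bounded_linear.linear linear_scale mult.commute)
  ultimately show ?thesis unfolding diag_semigroup_def by (simp add: sums_iff)
qed

end

section \<open>Duhamel integrals of a contraction semigroup\<close>

lemma set_integrable_scaleR_continuous:
  fixes h :: "real \<Rightarrow> 'a::{banach,second_countable_topology}"
  assumes p: "set_integrable lborel {a..b} p" and h: "continuous_on {a..b} h"
  shows "set_integrable lborel {a..b} (\<lambda>s. p s *\<^sub>R h s)"
proof -
  have "bounded (h ` {a..b})"
    by (intro compact_imp_bounded compact_continuous_image h) simp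
  then obtain C where C: "\<And>s. s \<in> {a..b} \<Longrightarrow> norm (h s) \<le> C"
    by (force simp: bounded_iff)
  have "set_borel_measurable lborel {a..b} (\<lambda>s. p s *\<^sub>R h s)"
  proof -
    have "(\<lambda>s. indicator {a..b} s *\<^sub>R p s) \<in> borel_measurable lborel"
      using p unfolding set_integrable_def by (rule borel_measurable_integrable)
    moreover have "(\<lambda>s. indicator {a..b} s *\<^sub>R h s) \<in> borel_measurable lborel"
      using borel_measurable_continuous_on_indicator[OF _ h] by simp
    ultimately have "(\<lambda>s. (indicator {a..b} s *\<^sub>R p s) *\<^sub>R (indicator {a..b} s *\<^sub>R h s))
        \<in> borel_measurable lborel"
      by (rule borel_measurable_scaleR)
    moreover have "(\<lambda>s. (indicator {a..b} s *\<^sub>R p s) *\<^sub>R (indicator {a..b} s *\<^sub>R h s))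
        = (\<lambda>s. indicator {a..b} s *\<^sub>R (p s *\<^sub>R h s))"
      by (auto simp: indicator_def)
    ultimately show ?thesis unfolding set_borel_measurable_def by simp
  qed
  moreover have "norm (p s *\<^sub>R h s) \<le> norm (C * p s)" if "s \<in> {a..b}" for s
    using mult_left_mono[OF order_trans[OF C[OF that] abs_ge_self], of "\<bar>p s\<bar>"]
    by (simp add: abs_mult mult.commute)
  ultimately show ?thesis
    by (intro set_integrable_bound[OF set_integrable_mult_right[OF p, of C]]) auto
qed

lemma set_integrable_Icc_subset:
  fixes f :: "real \<Rightarrow> 'a::{banach,second_countable_topology}"
  shows "set_integrable lborel {a..b} f \<Longrightarrow> a \<le> c \<Longrightarrow> d \<le> b \<Longrightarrow> set_integrable lborel {c..d} f"
  by (rule set_integrable_subset) auto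

lemma norm_set_integral_scaleR_le:
  fixes h :: "real \<Rightarrow> 'a::{banach,second_countable_topology}"
  assumes p: "set_integrable lborel {a..b} p" and h: "continuous_on {a..b} h"
    and G: "\<And>s. s \<in> {a..b} \<Longrightarrow> norm (h s) \<le> G"
  shows "norm (LBINT s:{a..b}. p s *\<^sub>R h s) \<le> (LBINT s:{a..b}. \<bar>p s\<bar>) * G"
proof -
  have i: "set_integrable lborel {a..b} (\<lambda>s. p s *\<^sub>R h s)"
    by (rule set_integrable_scaleR_continuous[OF p h])
  have "norm (LBINT s:{a..b}. p s *\<^sub>R h s) \<le> (LBINT s:{a..b}. norm (p s *\<^sub>R h s))"
    by (rule set_integral_norm_bound[OF i])
  also have "\<dots> \<le> (LBINT s:{a..b}. \<bar>p s\<bar> * G)"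
    using set_integrable_norm[OF i] set_integrable_abs[OF p] G
    by (intro set_integral_mono) (auto intro!: mult_left_mono)
  finally show ?thesis by simp
qed

lemma set_integral_abs_nonneg: "0 \<le> (LBINT s:A. \<bar>p s\<bar> :: real)"
  unfolding set_lebesgue_integral_def by (intro integral_nonneg_AE) auto

lemma set_integral_Icc_split:
  fixes f :: "real \<Rightarrow> 'a::{banach,second_countable_topology}"
  assumes f: "set_integrable lborel {a..c} f" and "a \<le> b" "b \<le> c"
  shows "(LBINT s:{a..c}. f s) = (LBINT s:{a..b}. f s) + (LBINT s:{b..c}. f s)"
proof -
  have "(LBINT s:{a..b}\<union>{b..c}. f s) = (LBINT s:{a..b}. f s) + (LBINT s:{b..c}. f s)"
  proof (rule set_integral_Un_AE)
    show "AE x in lborel. \<not> (x \<in> {a..b} \<and> x \<in> {b..c})"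
      using AE_lborel_singleton[of b] by eventually_elim auto
  qed (use set_integrable_Icc_subset[OF f] assms in auto)
  then show ?thesis using assms by (simp add: ivl_disj_un_two_touch)
qed

lemma set_integral_Icc_shift:
  fixes f :: "real \<Rightarrow> 'a::{banach,second_countable_topology}"
  shows "(LBINT s:{a..a+t}. f s) = (LBINT s:{0..t}. f (a + s))"
  unfolding set_lebesgue_integral_def
  by (subst lborel_integral_real_affine[of 1 _ a])
    (auto intro!: Bochner_Integration.integral_cong simp: indicator_def)

lemma set_integrable_Icc_shift:
  fixes f :: "real \<Rightarrow> 'a::{banach,second_countable_topology}"
  shows "set_integrable lborel {a..a+t} f \<longleftrightarrow> set_integrable lborel {0..t} (\<lambda>s. f (a + s))"
  unfolding set_integrable_def
  by (subst lborel_integrable_real_affine_iff[of 1 _ a, symmetric])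
    (auto intro!: Bochner_Integration.integrable_cong simp: indicator_def)

locale contraction_semigroup =
  fixes S :: "real \<Rightarrow> 'a::{banach,second_countable_topology} \<Rightarrow> 'a"
  assumes bounded_linear_S: "t \<ge> 0 \<Longrightarrow> bounded_linear (S t)"
    and norm_S_le: "t \<ge> 0 \<Longrightarrow> norm (S t x) \<le> norm x"
    and S_zero: "S 0 x = x"
    and S_add: "s \<ge> 0 \<Longrightarrow> t \<ge> 0 \<Longrightarrow> S (s + t) x = S s (S t x)"
    and continuous_S: "continuous_on {0..} (\<lambda>t. S t x)"
begin

lemma linear_S: "t \<ge> 0 \<Longrightarrow> linear (S t)"
  by (simp add: bounded_linear.linear bounded_linear_S)

text \<open>Strong continuity and the uniform bound by 1 together give joint continuity.\<close>

lemma continuous_on_S: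
  assumes \<tau>: "continuous_on A \<tau>" and g: "continuous_on A g" and nonneg: "\<And>s. s \<in> A \<Longrightarrow> 0 \<le> \<tau> s"
  shows "continuous_on A (\<lambda>s. S (\<tau> s) (g s))"
  unfolding continuous_on_def
proof
  fix s0 assume s0: "s0 \<in> A"
  have ev: "eventually (\<lambda>s. s \<in> A) (at s0 within A)" by (simp add: eventually_at_filter)
  have "((\<lambda>s. g s - g s0) \<longlongrightarrow> 0) (at s0 within A)"
    using g s0 by (simp add: continuous_on_def LIM_zero)
  then have "((\<lambda>s. norm (g s - g s0)) \<longlongrightarrow> 0) (at s0 within A)" by (rule tendsto_norm_zero)
  then have "((\<lambda>s. S (\<tau> s) (g s - g s0)) \<longlongrightarrow> 0) (at s0 within A)"
    by (rule Lim_null_comparison[rotated])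
      (use ev in \<open>eventually_elim, auto intro: norm_S_le nonneg\<close>)
  moreover have "((\<lambda>s. S (\<tau> s) (g s0)) \<longlongrightarrow> S (\<tau> s0) (g s0)) (at s0 within A)"
    using continuous_on_compose2[OF continuous_S \<tau>, of "g s0"] nonneg s0
    by (auto simp: continuous_on_def)
  ultimately have "((\<lambda>s. S (\<tau> s) (g s - g s0) + S (\<tau> s) (g s0)) \<longlongrightarrow> 0 + S (\<tau> s0) (g s0)) (at s0 within A)"
    by (rule tendsto_add)
  then show "((\<lambda>s. S (\<tau> s) (g s)) \<longlongrightarrow> S (\<tau> s0) (g s0)) (at s0 within A)"
    unfolding add_0_left
    by (rule Lim_transform_eventually)
      (use ev in \<open>eventually_elim, simp add: linear_diff[OF linear_S] nonneg\<close>)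
qed

definition duhamel :: "(real \<Rightarrow> real) \<Rightarrow> (real \<Rightarrow> 'a) \<Rightarrow> real \<Rightarrow> 'a" where
  "duhamel p g t = (LBINT s:{0..t}. p s *\<^sub>R S (t - s) (g s))"

context
  fixes p :: "real \<Rightarrow> real" and T :: real
  assumes p: "set_integrable lborel {0..T} p"
begin

lemma continuous_on_S_diff:
  "continuous_on {0..T} g \<Longrightarrow> t \<le> T \<Longrightarrow> continuous_on {0..t} (\<lambda>s. S (t - s) (g s))"
  by (rule continuous_on_S) (auto intro!: continuous_intros elim: continuous_on_subset)

lemma integrable_duhamel:
  assumes "continuous_on {0..T} g" and "t \<le> T"
  shows "set_integrable lborel {0..t} (\<lambda>s. p s *\<^sub>R S (t - s) (g s))"
  using set_integrable_Icc_subset[OF p] assms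
  by (intro set_integrable_scaleR_continuous continuous_on_S_diff) auto

lemma norm_duhamel_le:
  assumes g: "continuous_on {0..T} g" and t: "0 \<le> t" "t \<le> T"
    and G: "\<And>s. s \<in> {0..T} \<Longrightarrow> norm (g s) \<le> G"
  shows "norm (duhamel p g t) \<le> (LBINT s:{0..T}. \<bar>p s\<bar>) * G"
proof -
  have "norm (S (t - s) (g s)) \<le> G" if "s \<in> {0..t}" for s
    using norm_S_le[of "t - s" "g s"] G[of s] that t by auto
  then have "norm (duhamel p g t) \<le> (LBINT s:{0..t}. \<bar>p s\<bar>) * G"
    unfolding duhamel_def using set_integrable_Icc_subset[OF p] g t
    by (intro norm_set_integral_scaleR_le continuous_on_S_diff) auto
  also have "(LBINT s:{0..t}. \<bar>p s\<bar>) \<le> (LBINT s:{0..T}. \<bar>p s\<bar>)"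
    using set_integral_Icc_split[OF set_integrable_abs[OF p], of t] t
      set_integral_abs_nonneg[of "{t..T}" p] by simp
  then have "(LBINT s:{0..t}. \<bar>p s\<bar>) * G \<le> (LBINT s:{0..T}. \<bar>p s\<bar>) * G"
    using G[of 0] t by (intro mult_right_mono) (auto intro: order_trans[OF norm_ge_zero])
  finally show ?thesis .
qed

lemma duhamel_add:
  assumes "continuous_on {0..T} g" "continuous_on {0..T} h" "0 \<le> t" "t \<le> T"
  shows "duhamel p (\<lambda>s. g s + h s) t = duhamel p g t + duhamel p h t"
  unfolding duhamel_def using assms
  by (subst set_integral_add(2)[symmetric])
    (auto intro!: integrable_duhamel set_lebesgue_integral_cong
      simp: linear_add[OF linear_S] scaleR_add_right)

lemma duhamel_diff:
  assumes "continuous_on {0..T} g" "continuous_on {0..T} h" "0 \<le> t" "t \<le> T"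
  shows "duhamel p (\<lambda>s. g s - h s) t = duhamel p g t - duhamel p h t"
  unfolding duhamel_def using assms
  by (subst set_integral_diff(2)[symmetric])
    (auto intro!: integrable_duhamel set_lebesgue_integral_cong
      simp: linear_diff[OF linear_S] scaleR_diff_right)

text \<open>
  Dominated convergence: when \<open>t\<close> varies, the integrand, cut off at \<open>t\<close>, can fail to converge only
  at \<open>s = t\<close>.
\<close>

lemma continuous_duhamel:
  assumes g: "continuous_on {0..T} g"
  shows "continuous_on {0..T} (duhamel p g)"
proof (rule continuous_on_sequentiallyI)
  fix x t assume x: "\<forall>n. x n \<in> {0..T}" and t: "t \<in> {0..T}" and lim: "x \<longlonglongrightarrow> t"
  have "bounded (g ` {0..T})"
    by (intro compact_imp_bounded compact_continuous_image g) simp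
  then obtain G where G: "\<And>s. s \<in> {0..T} \<Longrightarrow> norm (g s) \<le> G"
    by (force simp: bounded_iff)
  define F where "F t s = indicator {0..t} s *\<^sub>R (p s *\<^sub>R S (t - s) (g s))" for t s
  have meas: "F t \<in> borel_measurable lborel" if "t \<in> {0..T}" for t
    using integrable_duhamel[OF g, of t] that unfolding set_integrable_def F_def
    by (intro borel_measurable_integrable) auto
  have bound: "norm (F t s) \<le> indicator {0..T} s *\<^sub>R (\<bar>p s\<bar> * G)" if "t \<in> {0..T}" for t s
  proof (cases "s \<in> {0..t}")
    case True
    then have "norm (S (t - s) (g s)) \<le> G"
      using norm_S_le[of "t - s" "g s"] G[of s] that by auto
    then show ?thesis using True that by (auto simp: F_def intro: mult_left_mono)
  next
    case False
    have "0 \<le> G" using G[of t] that norm_ge_zero order_trans by blast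
    moreover have "F t s = 0" using False by (simp add: F_def)
    ultimately show ?thesis by simp
  qed
  have "(\<lambda>n. integral\<^sup>L lborel (F (x n))) \<longlonglongrightarrow> integral\<^sup>L lborel (F t)"
  proof (rule integral_dominated_convergence)
    show "integrable lborel (\<lambda>s. indicator {0..T} s *\<^sub>R (\<bar>p s\<bar> * G))"
      using set_integrable_mult_left[OF set_integrable_abs[OF p], of G]
      by (simp add: set_integrable_def)
    show "AE s in lborel. (\<lambda>n. F (x n) s) \<longlonglongrightarrow> F t s"
      using AE_lborel_singleton[of t]
    proof eventually_elim
      fix s :: real assume "s \<noteq> t"
      then consider "s < 0" | "s > t" | "0 \<le> s" "s < t" by linarith
      then show "(\<lambda>n. F (x n) s) \<longlonglongrightarrow> F t s"
      proof cases
        case 1 then show ?thesis by (simp add: F_def)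
      next
        case 2
        have "eventually (\<lambda>n. F (x n) s = F t s) sequentially"
          using order_tendstoD(2)[OF lim 2] by eventually_elim (use 2 in \<open>simp add: F_def\<close>)
        then show ?thesis by (rule tendsto_eventually)
      next
        case 3
        have ev: "eventually (\<lambda>n. s < x n) sequentially" by (rule order_tendstoD(1)[OF lim 3(2)])
        have "(\<lambda>n. S (x n - s) (g s)) \<longlonglongrightarrow> S (t - s) (g s)"
        proof (rule continuous_on_tendsto_compose[OF continuous_S])
          show "(\<lambda>n. x n - s) \<longlonglongrightarrow> t - s" by (intro tendsto_intros lim)
          show "\<forall>\<^sub>F n in sequentially. x n - s \<in> {0..}" using ev by eventually_elim simp
        qed (use 3 in simp)
        then have "(\<lambda>n. p s *\<^sub>R S (x n - s) (g s)) \<longlonglongrightarrow> F t s"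
          using 3 by (auto simp: F_def intro!: tendsto_intros)
        then show ?thesis
          by (rule Lim_transform_eventually) (use ev in \<open>eventually_elim, use 3 in \<open>simp add: F_def\<close>\<close>)
      qed
    qed
  qed (use meas bound x t in auto)
  moreover have "duhamel p g t = integral\<^sup>L lborel (F t)" for t
    unfolding duhamel_def set_lebesgue_integral_def F_def[abs_def] ..
  ultimately show "(\<lambda>n. duhamel p g (x n)) \<longlonglongrightarrow> duhamel p g t" by simp
qed

text \<open>The part of the integral up to time \<open>a\<close> is propagated by the semigroup law.\<close>

lemma duhamel_shift:
  assumes g: "continuous_on {0..T} g" and a: "0 \<le> a" and t: "0 \<le> t" and le: "a + t \<le> T"
  shows "duhamel p g (a + t) = S t (duhamel p g a) + duhamel (\<lambda>s. p (a + s)) (\<lambda>s. g (a + s)) t"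
proof -
  have "duhamel p g (a + t) = (LBINT s:{0..a}. p s *\<^sub>R S (a + t - s) (g s))
      + (LBINT s:{a..a+t}. p s *\<^sub>R S (a + t - s) (g s))"
    unfolding duhamel_def using assms by (intro set_integral_Icc_split integrable_duhamel) auto
  also have "(LBINT s:{a..a+t}. p s *\<^sub>R S (a + t - s) (g s))
      = duhamel (\<lambda>s. p (a + s)) (\<lambda>s. g (a + s)) t"
    unfolding duhamel_def by (subst set_integral_Icc_shift) (simp add: algebra_simps)
  also have "(LBINT s:{0..a}. p s *\<^sub>R S (a + t - s) (g s)) = S t (duhamel p g a)"
  proof -
    have i: "set_integrable lborel {0..a} (\<lambda>s. p s *\<^sub>R S (a - s) (g s))"
      using assms by (intro integrable_duhamel) auto
    have "(LBINT s:{0..a}. p s *\<^sub>R S (a + t - s) (g s))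
        = (LBINT s:{0..a}. S t (p s *\<^sub>R S (a - s) (g s)))"
      using t S_add[of t "a - _"]
      by (intro set_lebesgue_integral_cong) (auto simp: linear_scale[OF linear_S] algebra_simps)
    also have "\<dots> = (LBINT s. S t (indicator {0..a} s *\<^sub>R (p s *\<^sub>R S (a - s) (g s))))"
      unfolding set_lebesgue_integral_def using t by (simp add: linear_scale[OF linear_S])
    also have "\<dots> = S t (LBINT s. indicator {0..a} s *\<^sub>R (p s *\<^sub>R S (a - s) (g s)))"
      using i by (intro integral_bounded_linear bounded_linear_S t) (simp add: set_integrable_def)
    finally show ?thesis by (simp add: duhamel_def set_lebesgue_integral_def)
  qed
  finally show ?thesis .
qed

end

end

section \<open>The bilinear equation with small controls\<close>

text \<open>A Gronwall argument without exponentials: evaluate the hypothesis at the maximum of the norm.\<close>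

lemma bounded_by_self_improvement:
  fixes z :: "real \<Rightarrow> 'a::real_normed_vector"
  assumes z: "continuous_on {0..T} z"
    and improve: "\<And>M t. (\<And>s. s \<in> {0..T} \<Longrightarrow> norm (z s) \<le> M) \<Longrightarrow> t \<in> {0..T} \<Longrightarrow> norm (z t) \<le> \<alpha> + M / 2"
    and t: "t \<in> {0..T}"
  shows "norm (z t) \<le> 2 * \<alpha>"
proof -
  have "\<exists>r\<in>{0..T}. \<forall>s\<in>{0..T}. norm (z s) \<le> norm (z r)"
    by (rule continuous_attains_sup) (use z t in \<open>auto intro!: continuous_intros\<close>)
  then obtain r where r: "r \<in> {0..T}" "\<And>s. s \<in> {0..T} \<Longrightarrow> norm (z s) \<le> norm (z r)" by blast
  have "norm (z r) \<le> \<alpha> + norm (z r) / 2" by (rule improve[OF r(2) r(1)])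
  then show ?thesis using r(2)[OF t] by simp
qed

locale bilinear_system = contraction_semigroup S
  for S :: "real \<Rightarrow> 'a::{banach,second_countable_topology} \<Rightarrow> 'a" +
  fixes B :: "'a \<Rightarrow> 'a" and b :: real
  assumes bounded_linear_B: "bounded_linear B"
    and norm_B_le: "norm (B x) \<le> b * norm x"
    and b_ge_1: "b \<ge> 1"
begin

definition mild :: "real \<Rightarrow> (real \<Rightarrow> real) \<Rightarrow> 'a \<Rightarrow> (real \<Rightarrow> 'a) \<Rightarrow> bool" where
  "mild T p u0 u \<longleftrightarrow> continuous_on {0..T} u \<and>
     (\<forall>t\<in>{0..T}. u t = S t u0 - duhamel p (\<lambda>s. B (u s)) t)"

text \<open>
  Smallness in \<open>L\<^sup>1\<close> makes the Duhamel term a contraction with factor \<open>1/2\<close> for the supremum norm on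
  an interval of any length; in particular, waiting with zero control is free.
\<close>

definition small_control :: "real \<Rightarrow> (real \<Rightarrow> real) \<Rightarrow> bool" where
  "small_control T p \<longleftrightarrow> set_integrable lborel {0..T} p \<and> b * (LBINT s:{0..T}. \<bar>p s\<bar>) \<le> 1/2"

lemma linear_B: "linear B"
  by (simp add: bounded_linear.linear bounded_linear_B)

lemma continuous_B: "continuous_on A u \<Longrightarrow> continuous_on A (\<lambda>s. B (u s))"
  by (rule bounded_linear.continuous_on[OF bounded_linear_B])

lemma norm_duhamel_B_le:
  assumes p: "set_integrable lborel {0..T} p" and u: "continuous_on {0..T} u"
    and t: "t \<in> {0..T}" and M: "\<And>s. s \<in> {0..T} \<Longrightarrow> norm (u s) \<le> M"
  shows "norm (duhamel p (\<lambda>s. B (u s)) t) \<le> b * (LBINT s:{0..T}. \<bar>p s\<bar>) * M"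
proof -
  have "norm (B (u s)) \<le> b * M" if "s \<in> {0..T}" for s
    using norm_B_le[of "u s"] mult_left_mono[OF M[OF that], of b] b_ge_1 by linarith
  then have "norm (duhamel p (\<lambda>s. B (u s)) t) \<le> (LBINT s:{0..T}. \<bar>p s\<bar>) * (b * M)"
    using t u by (intro norm_duhamel_le[OF p] continuous_B) auto
  then show ?thesis by (simp add: mult_ac)
qed

lemma norm_duhamel_B_small:
  assumes p: "small_control T p" and u: "continuous_on {0..T} u"
    and t: "t \<in> {0..T}" and M: "\<And>s. s \<in> {0..T} \<Longrightarrow> norm (u s) \<le> M"
  shows "norm (duhamel p (\<lambda>s. B (u s)) t) \<le> M / 2"
proof -
  have "M \<ge> 0" using M[OF t] norm_ge_zero order_trans by blast
  then have "b * (LBINT s:{0..T}. \<bar>p s\<bar>) * M \<le> 1/2 * M"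
    using p by (intro mult_right_mono) (auto simp: small_control_def)
  then show ?thesis
    using norm_duhamel_B_le[OF _ u t M] p by (force simp: small_control_def)
qed

lemma duhamel_B_diff:
  assumes p: "set_integrable lborel {0..T} p" and u: "continuous_on {0..T} u" "continuous_on {0..T} v"
    and t: "t \<in> {0..T}"
  shows "duhamel p (\<lambda>s. B (u s)) t - duhamel p (\<lambda>s. B (v s)) t = duhamel p (\<lambda>s. B (u s - v s)) t"
  using duhamel_diff[OF p continuous_B[OF u(1)] continuous_B[OF u(2)], of t] t
  by (simp add: linear_diff[OF linear_B])

lemma mild_unique:
  assumes p: "small_control T p" and u: "mild T p u0 u" and v: "mild T p u0 v" and t: "t \<in> {0..T}"
  shows "u t = v t"
proof -
  have c: "continuous_on {0..T} u" "continuous_on {0..T} v" using u v by (auto simp: mild_def)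
  have "norm (u t - v t) \<le> 2 * 0"
  proof (rule bounded_by_self_improvement[OF _ _ t])
    show "continuous_on {0..T} (\<lambda>s. u s - v s)" by (intro continuous_intros c)
    fix M s assume M: "\<And>s. s \<in> {0..T} \<Longrightarrow> norm (u s - v s) \<le> M" and s: "s \<in> {0..T}"
    have "u s - v s = - duhamel p (\<lambda>s. B (u s - v s)) s"
      using duhamel_B_diff[OF _ c s, of p, symmetric] p u v s by (simp add: mild_def small_control_def)
    then show "norm (u s - v s) \<le> 0 + M / 2"
      using norm_duhamel_B_small[OF p _ s M] c by (simp add: continuous_intros)
  qed
  then show ?thesis by simp
qed

text \<open>
  Banach's fixed point theorem, applied on the real line to bounded continuous functions: values
  outside \<open>[0, T]\<close> are filled in by clamping the argument.
\<close>

lemma mild_exists: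
  assumes p: "small_control T p" and T: "T \<ge> 0"
  shows "\<exists>u. mild T p u0 u"
proof -
  have pi: "set_integrable lborel {0..T} p" using p by (simp add: small_control_def)
  define \<Phi> where "\<Phi> w t = S t u0 - duhamel p (\<lambda>s. B (w s)) t" for w t
  have "\<exists>g :: real \<Rightarrow>\<^sub>C 'a. \<forall>x. apply_bcontfun g x = \<Phi> (apply_bcontfun w) (clamp 0 T x)" for w
  proof -
    have "continuous_on {0..T} (\<lambda>t. S t u0)"
      by (rule continuous_on_subset[OF continuous_S]) auto
    then have "continuous_on (cbox 0 T) (\<Phi> (apply_bcontfun w))"
      unfolding \<Phi>_def cbox_interval
      by (intro continuous_on_diff continuous_duhamel[OF pi] continuous_B) auto
    then show ?thesis using continuous_on_cbox_bcontfunE by metis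
  qed
  then obtain \<Psi> :: "(real \<Rightarrow>\<^sub>C 'a) \<Rightarrow> real \<Rightarrow>\<^sub>C 'a"
    where \<Psi>: "\<And>w x. apply_bcontfun (\<Psi> w) x = \<Phi> (apply_bcontfun w) (clamp 0 T x)"
    by metis
  have "dist (\<Psi> w) (\<Psi> w') \<le> 1/2 * dist w w'" for w w'
  proof (rule dist_bound)
    fix x
    have x: "clamp 0 T x \<in> {0..T}" using clamp_in_interval[of 0 T x] T by auto
    have "dist (\<Psi> w x) (\<Psi> w' x) = norm (duhamel p (\<lambda>s. B (w s)) (clamp 0 T x) - duhamel p (\<lambda>s. B (w' s)) (clamp 0 T x))"
      by (simp add: \<Psi> \<Phi>_def dist_norm norm_minus_commute)
    also have "\<dots> = norm (duhamel p (\<lambda>s. B (w s - w' s)) (clamp 0 T x))"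
      by (subst duhamel_B_diff[OF pi _ _ x]) auto
    also have "\<dots> \<le> dist w w' / 2"
      by (rule norm_duhamel_B_small[OF p _ x])
        (auto intro!: continuous_intros simp: dist_norm[symmetric] dist_bounded)
    finally show "dist (\<Psi> w x) (\<Psi> w' x) \<le> 1/2 * dist w w'" by simp
  qed
  then have "\<exists>!w. \<Psi> w = w" by (intro banach_fix_type[of "1/2"]) auto
  then obtain w where w: "\<Psi> w = w" by blast
  have "w t = S t u0 - duhamel p (\<lambda>s. B (w s)) t" if "t \<in> {0..T}" for t
  proof -
    have "clamp 0 T t = t" using that by (intro clamp_cancel_cbox) simp
    then show ?thesis using \<Psi>[of w t] by (simp add: w \<Phi>_def)
  qed
  then have "mild T p u0 (apply_bcontfun w)" by (simp add: mild_def)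
  then show ?thesis by blast
qed

lemma mild_shift:
  assumes p: "set_integrable lborel {0..T} p" and u: "mild T p u0 u"
    and a: "0 \<le> a" and \<tau>: "0 \<le> \<tau>" "a + \<tau> \<le> T"
  shows "mild \<tau> (\<lambda>s. p (a + s)) (u a) (\<lambda>s. u (a + s))"
  unfolding mild_def
proof (intro conjI ballI)
  have c: "continuous_on {0..T} u" using u by (simp add: mild_def)
  show "continuous_on {0..\<tau>} (\<lambda>s. u (a + s))"
    by (rule continuous_on_compose2[OF c]) (use a \<tau> in \<open>auto intro!: continuous_intros\<close>)
  fix t assume t: "t \<in> {0..\<tau>}"
  have "u (a + t) = S (a + t) u0 - duhamel p (\<lambda>s. B (u s)) (a + t)"
    using u a \<tau> t by (simp add: mild_def)
  also have "duhamel p (\<lambda>s. B (u s)) (a + t)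
      = S t (duhamel p (\<lambda>s. B (u s)) a) + duhamel (\<lambda>s. p (a + s)) (\<lambda>s. B (u (a + s))) t"
    using a \<tau> t by (intro duhamel_shift[OF p] continuous_B c) auto
  also have "S (a + t) u0 = S t (S a u0)" using S_add[of t a u0] a t by (simp add: add.commute)
  also have "S a u0 = u a + duhamel p (\<lambda>s. B (u s)) a" using u a \<tau> by (simp add: mild_def)
  finally show "u (a + t) = S t (u a) - duhamel (\<lambda>s. p (a + s)) (\<lambda>s. B (u (a + s))) t"
    using t by (simp add: linear_add[OF linear_S])
qed

lemma mild_zero_control:
  assumes u: "mild T p u0 u" and zero: "\<And>s. 0 \<le> s \<Longrightarrow> s \<le> t \<Longrightarrow> p s = 0" and t: "t \<in> {0..T}"
  shows "u t = S t u0"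
proof -
  have "duhamel p (\<lambda>s. B (u s)) t = (LBINT s:{0..t}. 0)"
    unfolding duhamel_def by (intro set_lebesgue_integral_cong) (auto simp: zero)
  then show ?thesis using u t by (simp add: mild_def)
qed

end

section \<open>Square-integrable controls and their concatenation\<close>

text \<open>
  Young's inequality with weight \<open>\<delta>\<close> replaces the Cauchy-Schwarz inequality: integrating
  \<open>\<bar>p\<bar> \<le> \<delta>/2 + p\<^sup>2/(2\<delta>)\<close> over an interval of length at most 1 gives \<open>\<delta>/2 + \<delta>/2\<close>.
\<close>

lemma L2_control_imp_L1:
  assumes p: "L2_control T p" and T: "0 \<le> T" "T \<le> 1" and \<delta>: "L2_norm_control T p \<le> \<delta>" "\<delta> > 0"
  shows "set_integrable lborel {0..T} p" and "(LBINT s:{0..T}. \<bar>p s\<bar>) \<le> \<delta>"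
proof -
  have p2: "set_integrable lborel {0..T} (\<lambda>s. (p s)\<^sup>2)" using p by (simp add: L2_control_def)
  have const: "set_integrable lborel {0..T} (\<lambda>_. \<delta> / 2)"
    by (intro borel_integrable_atLeastAtMost') simp
  have dom: "set_integrable lborel {0..T} (\<lambda>s. \<delta> / 2 + (p s)\<^sup>2 / (2 * \<delta>))"
    using set_integrable_divide[OF p2] const by (intro set_integral_add(1)) auto
  have young: "\<bar>p s\<bar> \<le> \<delta> / 2 + (p s)\<^sup>2 / (2 * \<delta>)" for s
  proof -
    have "0 \<le> (\<bar>p s\<bar> - \<delta>)\<^sup>2 / (2 * \<delta>)" using \<delta> by simp
    also have "\<dots> = \<delta> / 2 + (p s)\<^sup>2 / (2 * \<delta>) - \<bar>p s\<bar>"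
      using \<delta> by (simp add: power2_eq_square field_simps)
    finally show ?thesis by simp
  qed
  show i: "set_integrable lborel {0..T} p"
    using p young by (intro set_integrable_bound[OF dom])
      (auto simp: L2_control_def intro: order_trans[OF _ abs_ge_self])
  have "(LBINT s:{0..T}. (p s)\<^sup>2) \<le> \<delta>\<^sup>2"
    using \<delta> by (simp add: L2_norm_control_def sqrt_le_D)
  then have "(LBINT s:{0..T}. (p s)\<^sup>2) / (2 * \<delta>) \<le> \<delta> / 2"
    using \<delta> by (simp add: field_simps power2_eq_square)
  moreover have "T * (\<delta> / 2) \<le> \<delta> / 2" using T \<delta> by simp
  moreover have "(LBINT s:{0..T}. \<bar>p s\<bar>) \<le> (LBINT s:{0..T}. \<delta> / 2 + (p s)\<^sup>2 / (2 * \<delta>))"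
    by (rule set_integral_mono[OF set_integrable_abs[OF i] dom young])
  moreover have "(LBINT s:{0..T}. \<delta> / 2 + (p s)\<^sup>2 / (2 * \<delta>))
      = T * (\<delta> / 2) + (LBINT s:{0..T}. (p s)\<^sup>2) / (2 * \<delta>)"
    using T by (subst set_integral_add(2)[OF const set_integrable_divide[OF p2]])
      (simp_all add: set_integral_const)
  ultimately show "(LBINT s:{0..T}. \<bar>p s\<bar>) \<le> \<delta>" by linarith
qed

locale time_grid =
  fixes t0 :: real and \<tau> :: "nat \<Rightarrow> real"
  assumes \<tau>_pos: "\<tau> n > 0"
begin

definition node :: "nat \<Rightarrow> real" where
  "node n = t0 + (\<Sum>i<n. \<tau> i)"

text \<open>
  The cells are open on the left, so that the concatenated control vanishes on all of \<open>[0, t0]\<close>.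
\<close>

definition cell :: "(nat \<Rightarrow> real \<Rightarrow> real) \<Rightarrow> nat \<Rightarrow> real \<Rightarrow> real" where
  "cell P n s = indicator {node n<..node (Suc n)} s * P n (s - node n)"

definition concat_control :: "(nat \<Rightarrow> real \<Rightarrow> real) \<Rightarrow> real \<Rightarrow> real" where
  "concat_control P s = (\<Sum>n. cell P n s)"

lemma node_Suc: "node (Suc n) = node n + \<tau> n"
  by (simp add: node_def)

lemma node_mono: "m \<le> n \<Longrightarrow> node m \<le> node n"
  by (rule lift_Suc_mono_le) (use \<tau>_pos less_imp_le in \<open>auto simp: node_Suc\<close>)

lemma node_ge: "t0 \<le> node n"
  using node_mono[of 0 n] by (simp add: node_def)

lemma cell_disjoint: "s \<in> {node n<..node (Suc n)} \<Longrightarrow> m \<noteq> n \<Longrightarrow> cell P m s = 0"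
  using node_mono[of "Suc m" n] node_mono[of "Suc n" m]
  by (cases "m < n") (auto simp: cell_def indicator_def)

lemma cell_sums: "s \<in> {node n<..node (Suc n)} \<Longrightarrow> (\<lambda>m. cell P m s) sums cell P n s"
  by (intro sums_finite[of "{n}", simplified]) (use cell_disjoint in auto)

lemma cell_sums_concat: "(\<lambda>m. cell P m s) sums concat_control P s"
proof (cases "\<exists>n. s \<in> {node n<..node (Suc n)}")
  case True
  then show ?thesis using cell_sums unfolding concat_control_def by (auto simp: sums_iff)
next
  case False
  then have "cell P m s = 0" for m by (auto simp: cell_def indicator_def)
  then show ?thesis unfolding concat_control_def by simp
qed

lemma concat_control_cell:
  "s \<in> {node n<..node (Suc n)} \<Longrightarrow> concat_control P s = P n (s - node n)"
  using sums_unique2[OF cell_sums cell_sums_concat, of s n P] by (simp add: cell_def)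

lemma concat_control_before:
  assumes "s \<le> t0"
  shows "concat_control P s = 0"
proof -
  have "cell P n s = 0" for n using node_ge[of n] assms by (simp add: cell_def)
  then show ?thesis by (simp add: concat_control_def)
qed

lemma concat_control_map:
  assumes "g 0 = 0"
  shows "concat_control (\<lambda>n s. g (P n s)) s = g (concat_control P s)"
proof (cases "\<exists>n. s \<in> {node n<..node (Suc n)}")
  case True
  then show ?thesis by (auto simp: concat_control_cell)
next
  case False
  then have "cell Q m s = 0" for Q m by (auto simp: cell_def indicator_def)
  then show ?thesis unfolding concat_control_def by (simp add: assms)
qed

text \<open>The cells are disjoint, so the absolute value of the sum is the sum of the absolute values.\<close>

lemma integrable_concat_control:
  assumes P: "\<And>n. set_integrable lborel {0..\<tau> n} (P n)"
    and bound: "\<And>n. (LBINT s:{0..\<tau> n}. \<bar>P n s\<bar>) \<le> \<delta> n" and \<delta>: "summable \<delta>"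
  shows "integrable lborel (concat_control P)"
    and "(LBINT s. \<bar>concat_control P s\<bar>) \<le> suminf \<delta>"
proof -
  have shifted: "set_integrable lborel {node n..node (Suc n)} (\<lambda>s. P n (s - node n))" for n
    unfolding node_Suc by (subst set_integrable_Icc_shift) (use P in simp)
  have int: "integrable lborel (cell P n)" for n
  proof -
    have "set_integrable lborel {node n<..node (Suc n)} (\<lambda>s. P n (s - node n))"
      by (rule set_integrable_subset[OF shifted]) auto
    then show ?thesis unfolding set_integrable_def cell_def[abs_def] by simp
  qed
  have le: "(LBINT s. norm (cell P n s)) \<le> \<delta> n" for n
  proof -
    have "(LBINT s. norm (cell P n s)) \<le> (LBINT s:{node n..node (Suc n)}. \<bar>P n (s - node n)\<bar>)"
      unfolding set_lebesgue_integral_def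
    proof (rule integral_mono[OF integrable_norm[OF int]])
      show "integrable lborel (\<lambda>s. indicator {node n..node (Suc n)} s *\<^sub>R \<bar>P n (s - node n)\<bar>)"
        using set_integrable_abs[OF shifted] by (simp add: set_integrable_def)
    qed (auto simp: cell_def indicator_def abs_mult)
    also have "\<dots> = (LBINT s:{0..\<tau> n}. \<bar>P n s\<bar>)"
      unfolding node_Suc by (subst set_integral_Icc_shift) simp
    finally show ?thesis using bound[of n] by simp
  qed
  have sm: "summable (\<lambda>n. LBINT s. norm (cell P n s))"
    by (rule summable_comparison_test'[OF \<delta>]) (use le in simp)
  have cell_abs: "norm (cell P n s) = cell (\<lambda>n s. \<bar>P n s\<bar>) n s" for n s
    by (simp add: cell_def indicator_def abs_mult)
  have ptw: "summable (\<lambda>n. norm (cell P n s))" for s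
    unfolding cell_abs using cell_sums_concat by (rule sums_summable)
  show "integrable lborel (concat_control P)"
    using integrable_suminf[OF int _ sm] ptw unfolding concat_control_def[abs_def] by simp
  have "(LBINT s. \<bar>concat_control P s\<bar>) = (LBINT s. (\<Sum>n. norm (cell P n s)))"
    unfolding cell_abs concat_control_def[symmetric] by (subst concat_control_map) auto
  also have "\<dots> = (\<Sum>n. LBINT s. norm (cell P n s))"
    by (rule integral_suminf) (use int ptw sm in auto)
  also have "\<dots> \<le> suminf \<delta>" by (rule suminf_le[OF le sm \<delta>])
  finally show "(LBINT s. \<bar>concat_control P s\<bar>) \<le> suminf \<delta>" .
qed

end

section \<open>Steering to a fixed point by infinitely many linear steps\<close>

context bilinear_system
begin

lemma duhamel_cong:
  assumes p: "set_integrable lborel {0..T} p" "set_integrable lborel {0..T} q"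
    and eq: "\<And>s. 0 < s \<Longrightarrow> s \<le> T \<Longrightarrow> p s = q s"
    and g: "continuous_on {0..T} g" and t: "t \<in> {0..T}"
  shows "duhamel p g t = duhamel q g t"
  unfolding duhamel_def set_lebesgue_integral_def
proof (rule integral_cong_AE)
  show "AE s in lborel. indicator {0..t} s *\<^sub>R p s *\<^sub>R S (t - s) (g s)
      = indicator {0..t} s *\<^sub>R q s *\<^sub>R S (t - s) (g s)"
    using AE_lborel_singleton[of 0] by eventually_elim (use t eq in \<open>auto simp: indicator_def\<close>)
qed (use integrable_duhamel[OF p(1) g, of t] integrable_duhamel[OF p(2) g, of t] t
    in \<open>auto simp: set_integrable_def dest: borel_measurable_integrable\<close>)

text \<open>
  A concatenated control restarted at a node differs from the next piece at time 0, where it still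
  has the last value of the preceding piece.
\<close>

lemma mild_cong:
  assumes "set_integrable lborel {0..T} p" "set_integrable lborel {0..T} q"
    and "\<And>s. 0 < s \<Longrightarrow> s \<le> T \<Longrightarrow> p s = q s"
    and u: "mild T p u0 u"
  shows "mild T q u0 u"
  using u duhamel_cong[OF assms(1-3) continuous_B] by (simp add: mild_def)

end

locale steerable_system = bilinear_system S B b
  for S :: "real \<Rightarrow> 'a::{banach,second_countable_topology} \<Rightarrow> 'a" and B :: "'a \<Rightarrow> 'a" and b :: real +
  fixes e :: 'a and c \<nu> T0 :: real
  assumes S_e: "t \<ge> 0 \<Longrightarrow> S t e = e" and norm_e: "norm e = 1"
    and c_ge_1: "c \<ge> 1" and \<nu>_pos: "\<nu> > 0" and T0_pos: "T0 > 0"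
    and null_control: "0 < \<tau> \<Longrightarrow> \<tau> \<le> T0 \<Longrightarrow>
      \<exists>p. L2_control \<tau> p \<and> L2_norm_control \<tau> p \<le> c * exp (\<nu> / \<tau>) * norm v \<and>
          S \<tau> v - duhamel p (\<lambda>_. B e) \<tau> = 0"
begin

text \<open>
  The control that steers the linearized system from \<open>v\<close> to \<open>0\<close> is applied to the bilinear one. The
  linear parts cancel at time \<open>\<tau>\<close>, and what remains is the Duhamel integral of \<open>p B (u - e)\<close>, in
  which both factors are of the size of the control: the error becomes quadratic.
\<close>

lemma quadratic_step:
  assumes \<tau>: "0 < \<tau>" "\<tau> \<le> T0" "\<tau> \<le> 1" and v: "norm (x - e) \<le> \<rho>" and \<rho>: "\<rho> > 0"
    and \<delta>: "\<delta> = c * exp (\<nu> / \<tau>) * \<rho>" and small: "b * \<delta> \<le> 1/2"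
  shows "\<exists>p u. L2_control \<tau> p \<and> L2_norm_control \<tau> p \<le> \<delta> \<and> mild \<tau> p x u \<and>
               norm (u \<tau> - e) \<le> (2 * (b * \<delta>))\<^sup>2"
proof -
  define v where "v = x - e"
  obtain p where p: "L2_control \<tau> p" "L2_norm_control \<tau> p \<le> c * exp (\<nu> / \<tau>) * norm v"
    and null: "S \<tau> v - duhamel p (\<lambda>_. B e) \<tau> = 0"
    using null_control[OF \<tau>(1,2)] by blast
  have "c * exp (\<nu> / \<tau>) * norm v \<le> \<delta>"
    unfolding \<delta> v_def using v c_ge_1 by (intro mult_left_mono) auto
  with p have norm_p: "L2_norm_control \<tau> p \<le> \<delta>" by linarith
  have "exp 0 \<le> exp (\<nu> / \<tau>)" using \<tau> \<nu>_pos by (subst exp_le_cancel_iff) simp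
  then have "1 * 1 \<le> c * exp (\<nu> / \<tau>)" using c_ge_1 by (intro mult_mono) auto
  then have "1 * \<rho> \<le> \<delta>" unfolding \<delta> using \<rho> by (intro mult_right_mono) auto
  then have \<rho>\<delta>: "\<rho> \<le> \<delta>" "\<delta> > 0" using \<rho> by auto
  have pi: "set_integrable lborel {0..\<tau>} p" and p1: "(LBINT s:{0..\<tau>}. \<bar>p s\<bar>) \<le> \<delta>"
    using L2_control_imp_L1[OF p(1) _ \<tau>(3) norm_p \<rho>\<delta>(2)] \<tau> by auto
  have bp: "b * (LBINT s:{0..\<tau>}. \<bar>p s\<bar>) \<le> b * \<delta>" using p1 b_ge_1 by (intro mult_left_mono) auto
  then have sc: "small_control \<tau> p" using pi small by (simp add: small_control_def)
  then obtain u where u: "mild \<tau> p x u" using mild_exists \<tau> by (meson less_imp_le)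
  then have cu: "continuous_on {0..\<tau>} u" by (simp add: mild_def)
  define z where "z s = u s - e" for s
  have cz: "continuous_on {0..\<tau>} z" unfolding z_def by (intro continuous_intros cu)
  have z: "z t = S t v - duhamel p (\<lambda>_. B e) t - duhamel p (\<lambda>s. B (z s)) t" if t: "t \<in> {0..\<tau>}" for t
  proof -
    have "duhamel p (\<lambda>s. B (u s)) t = duhamel p (\<lambda>s. B e + B (z s)) t"
      by (simp add: z_def linear_diff[OF linear_B])
    also have "\<dots> = duhamel p (\<lambda>_. B e) t + duhamel p (\<lambda>s. B (z s)) t"
      using t by (intro duhamel_add[OF pi] continuous_B cz) auto
    moreover have "S t v = S t x - e"
      using t by (simp add: v_def linear_diff[OF linear_S] S_e)
    ultimately show ?thesis using u t by (simp add: mild_def z_def)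
  qed
  have "norm (z t) \<le> 2 * (2 * (b * \<delta>))" if "t \<in> {0..\<tau>}" for t
  proof (rule bounded_by_self_improvement[OF cz _ that])
    fix M t assume M: "\<And>s. s \<in> {0..\<tau>} \<Longrightarrow> norm (z s) \<le> M" and t: "t \<in> {0..\<tau>}"
    have "norm (S t v) \<le> b * \<delta>"
    proof -
      have "norm (S t v) \<le> norm v" using t by (simp add: norm_S_le)
      also have "\<dots> \<le> 1 * \<delta>" using v \<rho>\<delta> by (simp add: v_def)
      also have "\<dots> \<le> b * \<delta>" using b_ge_1 \<rho>\<delta> by (intro mult_right_mono) auto
      finally show ?thesis .
    qed
    moreover have "norm (duhamel p (\<lambda>_. B e) t) \<le> b * \<delta>"
      using norm_duhamel_B_le[OF pi continuous_on_const t, of e 1] norm_e bp by simp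
    moreover have "norm (duhamel p (\<lambda>s. B (z s)) t) \<le> M / 2"
      by (rule norm_duhamel_B_small[OF sc cz t M])
    ultimately show "norm (z t) \<le> 2 * (b * \<delta>) + M / 2"
      unfolding z[OF t]
      using norm_triangle_ineq4[of "S t v - duhamel p (\<lambda>_. B e) t" "duhamel p (\<lambda>s. B (z s)) t"]
        norm_triangle_ineq4[of "S t v" "duhamel p (\<lambda>_. B e) t"] by linarith
  qed
  then have "norm (duhamel p (\<lambda>s. B (z s)) \<tau>) \<le> b * (LBINT s:{0..\<tau>}. \<bar>p s\<bar>) * (4 * (b * \<delta>))"
    using \<tau> by (intro norm_duhamel_B_le[OF pi cz]) auto
  also have "\<dots> \<le> (b * \<delta>) * (4 * (b * \<delta>))"
    using bp b_ge_1 \<rho>\<delta> by (intro mult_right_mono) auto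
  finally have "norm (u \<tau> - e) \<le> (2 * (b * \<delta>))\<^sup>2"
    using z[of \<tau>] null \<tau> by (simp add: z_def power2_eq_square)
  then show ?thesis using p(1) norm_p u by blast
qed

text \<open>
  The cost \<open>exp (\<nu> / \<tau>)\<close> has to be beaten by the quadratic gain while the step lengths stay
  summable. With \<open>\<tau>\<close> decreasing like \<open>(2/3)^n\<close> the exponent of the cost grows like \<open>(3/2)^n\<close>, and
  so may the exponent of the error, since squaring allows for a growth by a factor up to 2: for a
  large constant \<open>M\<close> the ansatz \<open>\<rho> n = exp (- M (3/2)^n)\<close> reproduces itself.
\<close>

lemma step_parameters:
  obtains \<tau> \<rho> \<delta> :: "nat \<Rightarrow> real" where
    "\<And>n. 0 < \<tau> n" "\<And>n. \<tau> n \<le> T0" "\<And>n. \<tau> n \<le> 1" "summable \<tau>"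
    "\<And>n. \<rho> n > 0" "\<And>n. \<delta> n = c * exp (\<nu> / \<tau> n) * \<rho> n"
    "\<And>n. 2 * (b * \<delta> n) \<le> (1/2) ^ Suc n" "\<And>n. (2 * (b * \<delta> n))\<^sup>2 \<le> \<rho> (Suc n)" "\<rho> \<longlonglongrightarrow> 0"
proof -
  define m where "m = min T0 1"
  have m: "0 < m" "m \<le> T0" "m \<le> 1" using T0_pos by (auto simp: m_def)
  define C where "C = 2 * b * c"
  have C: "C \<ge> 1" using mult_mono[of 1 b 1 c] b_ge_1 c_ge_1 by (simp add: C_def)
  \<comment> \<open>A quarter of \<open>M\<close> pays for \<open>C\<close> and the cost; the summand 4 makes the controls decay like \<open>(1/2)^n\<close>.\<close>
  define M where "M = 4 * (ln C + \<nu> / m) + 4"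
  have M: "M \<ge> 4" using C \<nu>_pos m by (simp add: M_def)
  define \<tau> where "\<tau> n = m * (2/3) ^ n" for n :: nat
  define \<rho> where "\<rho> n = exp (- M * (3/2) ^ n)" for n :: nat
  define \<delta> where "\<delta> n = c * exp (\<nu> / \<tau> n) * \<rho> n" for n
  have \<tau>: "0 < \<tau> n" "\<tau> n \<le> m" for n
    using m power_le_one[of "2/3::real" n] by (auto simp: \<tau>_def mult_left_le)
  have q: "1 + real n / 2 \<le> (3/2) ^ n" for n :: nat
    using Bernoulli_inequality[of "1/2" n] by simp
  have small: "2 * (b * \<delta> n) \<le> exp (- (3/4) * M * (3/2) ^ n)" for n
  proof -
    have \<nu>: "\<nu> / \<tau> n = \<nu> / m * (3/2) ^ n"
      by (simp add: \<tau>_def power_divide)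
    have "2 * (b * \<delta> n) = exp (ln C) * (exp (\<nu> / \<tau> n) * \<rho> n)"
      using C by (simp add: C_def \<delta>_def)
    also have "\<dots> = exp (ln C + (\<nu> / m - M) * (3/2) ^ n)"
      unfolding \<nu> \<rho>_def exp_add[symmetric] by (simp add: algebra_simps)
    also have "\<dots> \<le> exp (ln C * (3/2) ^ n + (\<nu> / m - M) * (3/2) ^ n)"
      using C by (simp add: mult_le_cancel_left1)
    also have "\<dots> \<le> exp (- (3/4) * M * (3/2) ^ n)"
    proof -
      have "ln C + \<nu> / m = (M - 4) / 4" by (simp add: M_def)
      then have "ln C + (\<nu> / m - M) \<le> - (3/4) * M" by (simp add: add_diff_eq field_simps)
      then have "(ln C + (\<nu> / m - M)) * (3/2) ^ n \<le> (- (3/4) * M) * (3/2) ^ n"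
        by (rule mult_right_mono) simp
      then show ?thesis by (simp add: algebra_simps)
    qed
    finally show ?thesis .
  qed
  have geom: "2 * (b * \<delta> n) \<le> (1/2) ^ Suc n" for n
  proof -
    have "real (Suc n) \<le> 3 * (1 + real n / 2)" by simp
    also have "\<dots> \<le> (3/4 * M) * (3/2) ^ n" using M q[of n] by (intro mult_mono) auto
    finally have "exp (- (3/4) * M * (3/2) ^ n) \<le> exp (- real (Suc n))" by simp
    also have "\<dots> = (exp (- 1)) ^ Suc n" using exp_of_nat_mult[of "Suc n" "- 1::real"] by simp
    also have "\<dots> \<le> (1/2) ^ Suc n"
    proof (rule power_mono)
      have "exp 1 \<ge> (2::real)" using exp_ge_add_one_self[of 1] by simp
      then show "exp (- 1) \<le> (1/2::real)" by (simp add: exp_minus field_simps)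
    qed simp
    finally show ?thesis using small[of n] by linarith
  qed
  have pos: "0 < \<delta> n" for n using c_ge_1 by (simp add: \<delta>_def \<rho>_def)
  have square: "(2 * (b * \<delta> n))\<^sup>2 \<le> \<rho> (Suc n)" for n
  proof -
    have "(2 * (b * \<delta> n))\<^sup>2 \<le> (exp (- (3/4) * M * (3/2) ^ n))\<^sup>2"
      using small[of n] pos[of n] b_ge_1 by (intro power_mono) auto
    also have "\<dots> = exp (2 * (- (3/4) * M * (3/2) ^ n))" by (rule exp_double[symmetric])
    also have "2 * (- (3/4) * M * (3/2) ^ n) = - M * (3/2) ^ Suc n" by simp
    finally show ?thesis by (simp only: \<rho>_def)
  qed
  have "\<rho> \<longlonglongrightarrow> 0"
  proof (rule tendsto_sandwich[OF _ _ tendsto_const])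
    show "\<forall>\<^sub>F n in sequentially. \<rho> n \<le> (1/2) ^ Suc n"
    proof (intro always_eventually allI)
      fix n
      have "\<rho> n \<le> exp (- (3/4) * M * (3/2) ^ n)" using M by (simp add: \<rho>_def)
      have "exp 0 \<le> exp (\<nu> / \<tau> n)" using \<tau>[of n] \<nu>_pos by (subst exp_le_cancel_iff) simp
      then have "1 * 1 \<le> C * exp (\<nu> / \<tau> n)" using C by (intro mult_mono) auto
      then have "1 * \<rho> n \<le> C * exp (\<nu> / \<tau> n) * \<rho> n" by (intro mult_right_mono) (auto simp: \<rho>_def)
      then show "\<rho> n \<le> (1/2) ^ Suc n" using geom[of n] by (simp add: \<delta>_def C_def mult_ac)
    qed
    show "(\<lambda>n. (1/2::real) ^ Suc n) \<longlonglongrightarrow> 0" by (intro LIMSEQ_Suc LIMSEQ_power_zero) simp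
  qed (simp add: \<rho>_def)
  moreover have "summable \<tau>" unfolding \<tau>_def by (intro summable_mult summable_geometric) simp
  ultimately show thesis
    using that[of \<tau> \<rho> \<delta>] \<tau> m \<delta>_def geom square by (auto simp: \<rho>_def intro: order_trans)
qed

text \<open>
  After the waiting time \<open>t0\<close> the quadratic step is repeated on the cells of a grid with nodes
  converging to \<open>t0 + T\<close>. The controls have summable \<open>L\<^sup>1\<close> and \<open>L\<^sup>2\<close> norms, so their concatenation is a
  single control on \<open>[0, t0 + T]\<close>, small enough for a global solution to exist. By uniqueness this
  solution passes through the chosen states at the nodes, and by continuity it is at their limit
  \<open>e\<close> at time \<open>t0 + T\<close>.
\<close>

lemma steering:
  "\<exists>r>0. \<exists>T>0. \<forall>t0\<ge>0. \<forall>u0. norm (S t0 u0 - e) \<le> r \<longrightarrow>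
     (\<exists>p u. L2_control (t0 + T) p \<and> mild (t0 + T) p u0 u \<and> u (t0 + T) = e)"
proof -
  obtain \<tau> \<rho> \<delta> where \<tau>: "\<And>n. 0 < \<tau> n" "\<And>n. \<tau> n \<le> T0" "\<And>n. \<tau> n \<le> 1" "summable \<tau>"
    and \<rho>: "\<And>n. \<rho> n > 0" and \<delta>: "\<And>n. \<delta> n = c * exp (\<nu> / \<tau> n) * \<rho> n"
    and geom: "\<And>n. 2 * (b * \<delta> n) \<le> (1/2) ^ Suc n"
    and square: "\<And>n. (2 * (b * \<delta> n))\<^sup>2 \<le> \<rho> (Suc n)" and \<rho>_lim: "\<rho> \<longlonglongrightarrow> 0"
    by (rule step_parameters) blast
  have b_pos: "b > 0" using b_ge_1 by simp
  have \<delta>_pos: "\<delta> n > 0" for n using c_ge_1 \<rho> by (simp add: \<delta>)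
  have \<delta>_le: "\<delta> n \<le> (1/2) ^ Suc n / (2 * b)" for n
    using geom[of n] b_pos by (simp add: field_simps)
  have \<delta>_sums: "(\<lambda>n. (1/2) ^ Suc n / (2 * b)) sums (1 / (2 * b))"
    by (rule sums_divide[OF power_half_series])
  have \<delta>_summable: "summable \<delta>"
    by (rule summable_comparison_test'[OF sums_summable[OF \<delta>_sums]]) (use \<delta>_le \<delta>_pos in \<open>simp add: less_imp_le\<close>)
  have \<delta>_suminf: "suminf \<delta> \<le> 1 / (2 * b)"
    using suminf_le[OF \<delta>_le \<delta>_summable sums_summable[OF \<delta>_sums]] sums_unique[OF \<delta>_sums] by simp
  have b\<delta>: "b * \<delta> n \<le> 1/2" for n
  proof -
    have "(1/2::real) ^ Suc n \<le> 1" by (intro power_le_one) auto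
    then show ?thesis using geom[of n] by linarith
  qed
  define T where "T = suminf \<tau>"
  have T_pos: "T > 0" unfolding T_def by (intro suminf_pos \<tau>)
  have "\<exists>p u. L2_control (t0 + T) p \<and> mild (t0 + T) p u0 u \<and> u (t0 + T) = e"
    if t0: "t0 \<ge> 0" and start: "norm (S t0 u0 - e) \<le> \<rho> 0" for t0 u0
  proof -
    \<comment> \<open>The control of each step depends on the state in which the previous step ended.\<close>
    have "\<exists>x. (\<forall>n. (norm (x n - e) \<le> \<rho> n \<and> (n = 0 \<longrightarrow> x n = S t0 u0)) \<and>
        (\<exists>p u. L2_control (\<tau> n) p \<and> L2_norm_control (\<tau> n) p \<le> \<delta> n \<and> mild (\<tau> n) p (x n) u \<and> u (\<tau> n) = x (Suc n)))"
    proof (rule dependent_nat_choice)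
      show "\<exists>x. norm (x - e) \<le> \<rho> 0 \<and> (0 = 0 \<longrightarrow> x = S t0 u0)" using start by blast
      fix x n assume "norm (x - e) \<le> \<rho> n \<and> (n = (0::nat) \<longrightarrow> x = S t0 u0)"
      then obtain p u where "L2_control (\<tau> n) p" "L2_norm_control (\<tau> n) p \<le> \<delta> n"
        "mild (\<tau> n) p x u" "norm (u (\<tau> n) - e) \<le> (2 * (b * \<delta> n))\<^sup>2"
        using quadratic_step[OF \<tau>(1-3) _ \<rho> \<delta> b\<delta>, of x n] by blast
      then show "\<exists>y. (norm (y - e) \<le> \<rho> (Suc n) \<and> (Suc n = 0 \<longrightarrow> y = S t0 u0)) \<and>
          (\<exists>p u. L2_control (\<tau> n) p \<and> L2_norm_control (\<tau> n) p \<le> \<delta> n \<and> mild (\<tau> n) p x u \<and> u (\<tau> n) = y)"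
        using square[of n] by (intro exI[of _ "u (\<tau> n)"]) auto
    qed
    then obtain x P w where x: "\<And>n. norm (x n - e) \<le> \<rho> n" "x 0 = S t0 u0"
      and P: "\<And>n. L2_control (\<tau> n) (P n)" "\<And>n. L2_norm_control (\<tau> n) (P n) \<le> \<delta> n"
      and w: "\<And>n. mild (\<tau> n) (P n) (x n) (w n)" "\<And>n. w n (\<tau> n) = x (Suc n)"
      by metis
    interpret time_grid t0 \<tau> by unfold_locales (rule \<tau>)
    have P1: "set_integrable lborel {0..\<tau> n} (P n)" "(LBINT s:{0..\<tau> n}. \<bar>P n s\<bar>) \<le> \<delta> n" for n
      using L2_control_imp_L1[OF P(1) less_imp_le[OF \<tau>(1)] \<tau>(3) P(2) \<delta>_pos] by auto
    define p where "p = concat_control P"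
    have p_int: "integrable lborel p" and p_le: "(LBINT s. \<bar>p s\<bar>) \<le> suminf \<delta>"
      unfolding p_def using integrable_concat_control[OF P1 \<delta>_summable] by auto
    have p2_int: "integrable lborel (\<lambda>s. (p s)\<^sup>2)"
    proof -
      have "(LBINT s:{0..\<tau> n}. \<bar>(P n s)\<^sup>2\<bar>) \<le> (\<delta> n)\<^sup>2" for n
        using P(2)[of n] \<delta>_pos[of n] by (simp add: L2_norm_control_def sqrt_le_D)
      moreover have "summable (\<lambda>n. (\<delta> n)\<^sup>2)"
      proof (rule summable_comparison_test'[OF \<delta>_summable])
        fix n
        have "1 * \<delta> n \<le> b * \<delta> n" using b_ge_1 \<delta>_pos[of n] by (intro mult_right_mono) auto
        then have "\<delta> n \<le> 1" using b\<delta>[of n] by linarith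
        then show "norm ((\<delta> n)\<^sup>2) \<le> \<delta> n"
          using \<delta>_pos[of n] by (simp add: power2_eq_square mult_left_le)
      qed
      ultimately have "integrable lborel (concat_control (\<lambda>n s. (P n s)\<^sup>2))"
        using P(1) by (intro integrable_concat_control(1)) (auto simp: L2_control_def)
      then show ?thesis
        using concat_control_map[of "\<lambda>x. x\<^sup>2" P] unfolding p_def[symmetric]
        by (simp cong: Bochner_Integration.integrable_cong)
    qed
    have p_set: "set_integrable lborel A p" if "A \<in> sets lborel" for A
      unfolding set_integrable_def by (rule integrable_mult_indicator[OF that p_int])
    have L2: "L2_control (t0 + T) p"
      unfolding L2_control_def set_borel_measurable_def set_integrable_def
      using borel_measurable_integrable[OF p_int]
      by (intro conjI integrable_mult_indicator p2_int borel_measurable_scaleR) auto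
    have "(LBINT s:{0..t0+T}. \<bar>p s\<bar>) \<le> (LBINT s. \<bar>p s\<bar>)"
      unfolding set_lebesgue_integral_def using p_int
      by (intro integral_mono integrable_mult_indicator) (auto simp: indicator_def)
    also have "\<dots> \<le> 1 / (2 * b)" using p_le \<delta>_suminf by linarith
    finally have small: "small_control (t0 + T) p"
      using b_pos p_set by (simp add: small_control_def field_simps)
    obtain u where u: "mild (t0 + T) p u0 u" using mild_exists[OF small] t0 T_pos by fastforce
    have node_le: "node n \<le> t0 + T" for n
      unfolding node_def T_def using \<tau>(4) less_imp_le[OF \<tau>(1)] by (simp add: sum_le_suminf)
    have node_0: "node 0 = t0" by (simp add: node_def)
    have at_node: "u (node n) = x n" for n
    proof (induction n)
      case 0
      show ?case
        using mild_zero_control[OF u, of t0] concat_control_before t0 T_pos x(2) by (simp add: p_def node_0)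
    next
      case (Suc n)
      have node: "0 \<le> node n" "node n + \<tau> n \<le> t0 + T"
        using node_ge[of n] t0 node_le[of "Suc n"] by (auto simp: node_Suc)
      have "mild (\<tau> n) (\<lambda>s. p (node n + s)) (u (node n)) (\<lambda>s. u (node n + s))"
        using node \<tau>(1)[of n] p_set by (intro mild_shift[OF _ u]) auto
      moreover have "set_integrable lborel {0..\<tau> n} (\<lambda>s. p (node n + s))"
        unfolding set_integrable_Icc_shift[symmetric] by (intro p_set) simp
      moreover have "p (node n + s) = P n s" if "0 < s" "s \<le> \<tau> n" for s
        using that by (simp add: p_def node_Suc concat_control_cell[of _ n])
      ultimately have "mild (\<tau> n) (P n) (x n) (\<lambda>s. u (node n + s))"
        using mild_cong[OF _ P1(1)] Suc by auto
      moreover have "small_control (\<tau> n) (P n)"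
        using P1(1) order_trans[OF mult_left_mono[OF P1(2)[of n], of b] b\<delta>[of n]] b_pos
        by (auto simp: small_control_def)
      ultimately have "u (node n + \<tau> n) = w n (\<tau> n)"
        using mild_unique[OF _ _ w(1)] \<tau>(1)[of n] by auto
      then show ?case by (simp add: node_Suc w(2))
    qed
    have "x \<longlonglongrightarrow> e"
      by (rule LIM_zero_cancel, rule Lim_null_comparison[OF _ \<rho>_lim]) (use x(1) in simp)
    moreover have "x \<longlonglongrightarrow> u (t0 + T)"
    proof -
      have "node \<longlonglongrightarrow> t0 + T"
        unfolding node_def T_def by (intro tendsto_intros summable_LIMSEQ \<tau>(4))
      moreover have "\<forall>\<^sub>F n in sequentially. node n \<in> {0..t0 + T}"
        using t0 node_ge node_le by (auto intro!: always_eventually intro: order_trans)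
      ultimately have "(\<lambda>n. u (node n)) \<longlonglongrightarrow> u (t0 + T)"
        using u t0 T_pos by (intro continuous_on_tendsto_compose[of "{0..t0+T}" u]) (auto simp: mild_def)
      then show ?thesis by (simp add: at_node)
    qed
    ultimately have "u (t0 + T) = e" using LIMSEQ_unique by blast
    then show ?thesis using L2 u by blast
  qed
  then show ?thesis using \<rho>[of 0] T_pos by blast
qed

end

section \<open>The spectral system in the moving frame of the first eigensolution\<close>

text \<open>The infimum in the cost need not be attained, so \<open>K\<close> is taken strictly above the cost.\<close>

lemma null_control_of_cost:
  assumes nc: "null_controllable1 D A B v \<tau>" and cost: "control_cost D A B v \<tau> < K"
    and y0: "norm y0 = 1"
  shows "\<exists>p\<in>null_controls D A B v \<tau> y0. L2_norm_control \<tau> p < K"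
proof -
  define J where "J y = (INF p\<in>null_controls D A B v \<tau> y. L2_norm_control \<tau> p)" for y
  obtain N where N: "\<And>y. \<exists>p\<in>null_controls D A B v \<tau> y. L2_norm_control \<tau> p \<le> N * norm y"
    using nc unfolding null_controllable1_def by blast
  have nonneg: "0 \<le> L2_norm_control \<tau> p" for p
    unfolding L2_norm_control_def set_lebesgue_integral_def
    by (intro real_sqrt_ge_zero integral_nonneg_AE) auto
  have "J y \<le> N" if "y \<in> sphere 0 1" for y
  proof -
    obtain p where "p \<in> null_controls D A B v \<tau> y" "L2_norm_control \<tau> p \<le> N * norm y"
      using N by blast
    then show ?thesis
      unfolding J_def using that nonneg by (intro cINF_lower2) (auto intro!: bdd_belowI2[of _ 0])
  qed
  then have "bdd_above (J ` sphere 0 1)" by (rule bdd_aboveI2)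
  then have "J y0 \<le> control_cost D A B v \<tau>"
    unfolding control_cost_def J_def[symmetric] using y0 by (intro cSUP_upper) auto
  then have "J y0 < K" using cost by linarith
  moreover have "L2_norm_control \<tau> ` null_controls D A B v \<tau> y0 \<noteq> {}" using N[of y0] by blast
  ultimately obtain l where "l \<in> L2_norm_control \<tau> ` null_controls D A B v \<tau> y0" "l < K"
    unfolding J_def by (meson cInf_lessD)
  then show ?thesis by blast
qed

locale spectral_system =
  fixes D :: "'a::{real_inner,banach,second_countable_topology} set"
    and A :: "'a \<Rightarrow> 'a" and ev :: "nat \<Rightarrow> real" and \<phi> :: "nat \<Rightarrow> 'a"
  assumes densely: "densely_defined_linear D A" and selfadj: "self_adjoint D A"
    and eigen: "eigenbasis D A ev \<phi>"
begin

text \<open>The indices are shifted to start at zero, discarding the unconstrained value \<open>\<phi> 0\<close>.\<close>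

sublocale hilbert_basis "\<lambda>k. \<phi> (Suc k)"
proof
  have onb: "orthonormal_basis_seq \<phi>" using eigen by (simp add: eigenbasis_def)
  then show "\<phi> (Suc i) \<bullet> \<phi> (Suc j) = (if i = j then 1 else 0)" for i j
    by (auto simp: orthonormal_basis_seq_def norm_eq_1)
  have "range (\<lambda>k. \<phi> (Suc k)) = \<phi> ` {1..}"
    by (simp add: atLeast_Suc_greaterThan greaterThan_0 image_image)
  then show "closure (span (range (\<lambda>k. \<phi> (Suc k)))) = UNIV"
    using onb by (simp add: orthonormal_basis_seq_def)
qed

lemma ev_nonneg: "0 \<le> ev (Suc k)"
  using eigen by (simp add: eigenbasis_def)

lemma ev_mono: "m \<le> n \<Longrightarrow> ev (Suc m) \<le> ev (Suc n)"
  by (rule lift_Suc_mono_le[of "\<lambda>k. ev (Suc k)"]) (use eigen in \<open>auto simp: eigenbasis_def\<close>)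

definition e :: 'a where "e = \<phi> 1"

definition gap :: "nat \<Rightarrow> real" where "gap k = ev (Suc k) - ev 1"

lemma gap_nonneg: "0 \<le> gap k"
  using ev_mono[of 0 k] by (simp add: gap_def)

text \<open>The solution operator \<open>e\<^sup>\<lambda>\<^sup>t e\<^sup>-\<^sup>t\<^sup>A\<close> with \<open>\<lambda> = ev 1\<close>: in this frame the first eigensolution rests.\<close>

definition S :: "real \<Rightarrow> 'a \<Rightarrow> 'a" where "S = diag_semigroup gap"

lemma inner_S: "t \<ge> 0 \<Longrightarrow> S t x \<bullet> \<phi> (Suc k) = exp (- gap k * t) * (x \<bullet> \<phi> (Suc k))"
  unfolding S_def by (rule inner_diag) (rule gap_nonneg)

sublocale contraction_semigroup S
proof (rule contraction_semigroup.intro)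
  show "bounded_linear (S t)" if "t \<ge> 0" for t
    unfolding S_def by (rule bounded_linear_diag[OF gap_nonneg that])
  show "norm (S t x) \<le> norm x" if "t \<ge> 0" for t x
    unfolding S_def by (rule norm_diag[OF gap_nonneg that])
  show "S 0 x = x" for x
    unfolding S_def by (rule diag_0[OF gap_nonneg])
  show "S (s + t) x = S s (S t x)" if "s \<ge> 0" "t \<ge> 0" for s t x
    unfolding S_def by (rule diag_add[OF gap_nonneg that])
  show "continuous_on {0..} (\<lambda>t. S t x)" for x
    unfolding S_def by (rule continuous_diag[OF gap_nonneg])
qed

lemma exp_semigroup_eq: "t \<ge> 0 \<Longrightarrow> exp_semigroup D A t x = exp (- ev 1 * t) *\<^sub>R S t x"
proof (rule basis_ext)
  fix k assume t: "t \<ge> 0"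
  have eig: "\<phi> (Suc k) \<in> D" "A (\<phi> (Suc k)) = ev (Suc k) *\<^sub>R \<phi> (Suc k)" for k
    using eigen by (auto simp: eigenbasis_def)
  have "exp_semigroup D A t x = diag_semigroup (\<lambda>k. ev (Suc k)) t x"
    by (rule exp_semigroup_diag[OF densely selfadj ev_nonneg eig t])
  then have "exp_semigroup D A t x \<bullet> \<phi> (Suc k) = exp (- ev (Suc k) * t) * (x \<bullet> \<phi> (Suc k))"
    using inner_diag[OF ev_nonneg t] by simp
  also have "\<dots> = exp (- ev 1 * t) * exp (- gap k * t) * (x \<bullet> \<phi> (Suc k))"
    by (simp add: exp_add[symmetric] gap_def algebra_simps)
  finally show "exp_semigroup D A t x \<bullet> \<phi> (Suc k) = (exp (- ev 1 * t) *\<^sub>R S t x) \<bullet> \<phi> (Suc k)"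
    using t by (simp add: inner_S)
qed

lemma S_e: "t \<ge> 0 \<Longrightarrow> S t e = e"
  by (rule basis_ext) (use inner_basis[of 0] in \<open>auto simp: inner_S e_def gap_def\<close>)

lemma norm_e: "norm e = 1"
  using inner_basis[of 0 0] by (simp add: norm_eq_1 e_def)

lemma exp_convolution:
  assumes "t \<ge> 0"
  shows "(LBINT s:{0..t}. exp_semigroup D A (t - s) (p s *\<^sub>R g s))
    = exp (- ev 1 * t) *\<^sub>R duhamel p (\<lambda>s. exp (ev 1 * s) *\<^sub>R g s) t"
proof -
  have "exp_semigroup D A (t - s) (p s *\<^sub>R g s)
      = exp (- ev 1 * t) *\<^sub>R (p s *\<^sub>R S (t - s) (exp (ev 1 * s) *\<^sub>R g s))" if "s \<in> {0..t}" for s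
  proof -
    have "exp (- ev 1 * (t - s)) = exp (- ev 1 * t) * exp (ev 1 * s)"
      by (simp add: exp_add[symmetric] algebra_simps)
    then show ?thesis
      using that by (simp add: exp_semigroup_eq linear_scale[OF linear_S])
  qed
  then have "(LBINT s:{0..t}. exp_semigroup D A (t - s) (p s *\<^sub>R g s))
      = (LBINT s:{0..t}. exp (- ev 1 * t) *\<^sub>R (p s *\<^sub>R S (t - s) (exp (ev 1 * s) *\<^sub>R g s)))"
    by (intro set_lebesgue_integral_cong) auto
  then show ?thesis unfolding duhamel_def by (simp only: set_integral_scaleR_right)
qed

text \<open>
  If \<open>q\<close> is a null control for \<open>A\<close>, then \<open>exp (ev 1 * s) * q s\<close> is one for \<open>A - ev 1\<close>. The system is
  linear, so unit data suffice; on \<open>[0, 1]\<close> the weight costs at most the factor \<open>exp (ev 1)\<close>.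
\<close>

lemma null_control_moving_frame:
  assumes nc: "null_controllable1 D A B (\<phi> 1) \<tau>" and cost: "control_cost D A B (\<phi> 1) \<tau> < K"
    and \<tau>: "0 < \<tau>" "\<tau> \<le> 1"
  shows "\<exists>p. L2_control \<tau> p \<and> L2_norm_control \<tau> p \<le> exp (ev 1) * K * norm v \<and>
             S \<tau> v - duhamel p (\<lambda>_. B e) \<tau> = 0"
proof (cases "v = 0")
  case True
  have "L2_control \<tau> (\<lambda>_. 0)"
    by (simp add: L2_control_def set_borel_measurable_def set_integrable_def)
  then show ?thesis
    using True \<tau> by (intro exI[of _ "\<lambda>_. 0"])
      (simp add: L2_norm_control_def duhamel_def linear_0[OF linear_S])
next
  case False
  obtain q where q: "q \<in> null_controls D A B (\<phi> 1) \<tau> (v /\<^sub>R norm v)" and norm_q: "L2_norm_control \<tau> q < K"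
    using null_control_of_cost[OF nc cost, of "v /\<^sub>R norm v"] False by auto
  then obtain y where L2_q: "L2_control \<tau> q" and y: "linear_solution D A B (\<phi> 1) \<tau> q (v /\<^sub>R norm v) y" "y \<tau> = 0"
    by (auto simp: null_controls_def)
  define h where "h s = norm v * exp (ev 1 * s)" for s
  have ch: "continuous_on X h" for X unfolding h_def by (intro continuous_intros)
  have ev1: "0 \<le> ev 1" using ev_nonneg[of 0] by simp
  have h_le: "h s \<le> norm v * exp (ev 1)" if "s \<in> {0..\<tau>}" for s
    using that \<tau> ev1 mult_left_mono[of s 1 "ev 1"] by (simp add: h_def mult_left_mono)
  have h_nonneg: "0 \<le> h s" for s by (simp add: h_def)
  define p where "p s = h s * q s" for s
  have q_nonneg: "0 \<le> L2_norm_control \<tau> q"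
    unfolding L2_norm_control_def set_lebesgue_integral_def
    by (intro real_sqrt_ge_zero integral_nonneg_AE) auto
  have q1: "set_integrable lborel {0..\<tau>} q"
    using L2_control_imp_L1(1)[OF L2_q, of "L2_norm_control \<tau> q + 1"] q_nonneg \<tau> by simp
  have q2: "set_integrable lborel {0..\<tau>} (\<lambda>s. (q s)\<^sup>2)" using L2_q by (simp add: L2_control_def)
  have p1: "set_integrable lborel {0..\<tau>} p"
    using set_integrable_scaleR_continuous[OF q1 ch] by (simp add: p_def[abs_def] mult.commute)
  have p_sq: "(p s)\<^sup>2 = (q s)\<^sup>2 *\<^sub>R (h s)\<^sup>2" for s by (simp add: p_def power_mult_distrib mult.commute)
  have ch2: "continuous_on X (\<lambda>s. (h s)\<^sup>2)" for X by (intro continuous_intros ch)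
  have "L2_control \<tau> p"
    unfolding L2_control_def p_sq
    using p1 set_integrable_scaleR_continuous[OF q2 ch2]
    by (auto simp: set_integrable_def set_borel_measurable_def dest: borel_measurable_integrable)
  moreover have "L2_norm_control \<tau> p \<le> exp (ev 1) * K * norm v"
  proof -
    have "norm (LBINT s:{0..\<tau>}. (p s)\<^sup>2) \<le> (LBINT s:{0..\<tau>}. \<bar>(q s)\<^sup>2\<bar>) * (norm v * exp (ev 1))\<^sup>2"
      unfolding p_sq
    proof (rule norm_set_integral_scaleR_le[OF q2 ch2])
      show "norm ((h s)\<^sup>2) \<le> (norm v * exp (ev 1))\<^sup>2" if "s \<in> {0..\<tau>}" for s
        using power_mono[OF h_le[OF that] h_nonneg, of 2] by simp
    qed
    then have "(LBINT s:{0..\<tau>}. (p s)\<^sup>2) \<le> (LBINT s:{0..\<tau>}. (q s)\<^sup>2) * (norm v * exp (ev 1))\<^sup>2"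
      by (simp add: abs_le_iff)
    then have "L2_norm_control \<tau> p \<le> L2_norm_control \<tau> q * (norm v * exp (ev 1))"
      unfolding L2_norm_control_def
      by (rule order_trans[OF real_sqrt_le_mono]) (simp add: real_sqrt_mult)
    also have "\<dots> \<le> K * (norm v * exp (ev 1))"
      using norm_q by (intro mult_right_mono) auto
    finally show ?thesis by (simp add: mult_ac)
  qed
  moreover have "S \<tau> v - duhamel p (\<lambda>_. B e) \<tau> = 0"
  proof -
    have "0 = exp_semigroup D A \<tau> (v /\<^sub>R norm v)
        - (LBINT s:{0..\<tau>}. exp_semigroup D A (\<tau> - s) (q s *\<^sub>R B e))"
      using y \<tau> by (simp add: linear_solution_def mild_solution_def e_def)
    also have "\<dots> = exp (- ev 1 * \<tau>) *\<^sub>R (S \<tau> (v /\<^sub>R norm v) - duhamel q (\<lambda>s. exp (ev 1 * s) *\<^sub>R B e) \<tau>)"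
      using \<tau> by (simp add: exp_semigroup_eq exp_convolution scaleR_diff_right)
    finally have eq: "S \<tau> (v /\<^sub>R norm v) = duhamel q (\<lambda>s. exp (ev 1 * s) *\<^sub>R B e) \<tau>" by simp
    have "S \<tau> v = norm v *\<^sub>R S \<tau> (v /\<^sub>R norm v)"
      using False \<tau> by (simp add: linear_scale[OF linear_S])
    also have "\<dots> = (LBINT s:{0..\<tau>}. norm v *\<^sub>R (q s *\<^sub>R S (\<tau> - s) (exp (ev 1 * s) *\<^sub>R B e)))"
      unfolding eq duhamel_def by (simp only: set_integral_scaleR_right)
    also have "\<dots> = duhamel p (\<lambda>_. B e) \<tau>"
      unfolding duhamel_def
      by (intro set_lebesgue_integral_cong)
        (auto simp: linear_scale[OF linear_S] p_def h_def mult_ac)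
    finally show ?thesis by simp
  qed
  ultimately show ?thesis by blast
qed

text \<open>
  If the first eigenvalue were double, some nonzero combination \<open>\<psi>\<close> of \<open>\<phi> 1\<close> and \<open>\<phi> 2\<close> would be
  orthogonal to the direction \<open>w\<close> in which the control acts. In the moving frame the component
  along \<open>\<psi>\<close> is then constant in time, whatever the control, and cannot be steered to zero.
\<close>

lemma spectral_gap:
  assumes \<tau>: "\<tau> > 0" and null: "\<And>v. \<exists>p. set_integrable lborel {0..\<tau>} p \<and> S \<tau> v - duhamel p (\<lambda>_. w) \<tau> = 0"
  shows "ev 1 < ev 2"
proof (rule ccontr)
  assume "\<not> ev 1 < ev 2"
  then have eq: "ev 2 = ev 1" using ev_mono[of 0 1] by (simp add: numeral_2_eq_2)
  have fixed: "S t x \<bullet> \<phi> 1 = x \<bullet> \<phi> 1" "S t x \<bullet> \<phi> 2 = x \<bullet> \<phi> 2" if "t \<ge> 0" for t x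
    using inner_S[OF that, of x 0] inner_S[OF that, of x 1] eq by (simp_all add: numeral_2_eq_2 gap_def)
  have "\<exists>\<psi>. \<psi> \<noteq> 0 \<and> w \<bullet> \<psi> = 0 \<and> (\<forall>t\<ge>0. \<forall>x. S t x \<bullet> \<psi> = x \<bullet> \<psi>)"
  proof (cases "w \<bullet> \<phi> 1 = 0")
    case True
    then show ?thesis using norm_e fixed unfolding e_def by (intro exI[of _ "\<phi> 1"]) (auto simp del: One_nat_def)
  next
    case False
    define \<psi> where "\<psi> = (w \<bullet> \<phi> 2) *\<^sub>R \<phi> 1 - (w \<bullet> \<phi> 1) *\<^sub>R \<phi> 2"
    have "\<psi> \<bullet> \<phi> 2 = - (w \<bullet> \<phi> 1)"
      using inner_basis[of 0 1] inner_basis[of 1 1] by (simp add: \<psi>_def inner_diff_left numeral_2_eq_2)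
    then have "\<psi> \<noteq> 0" using False by auto
    moreover have "w \<bullet> \<psi> = 0" by (simp add: \<psi>_def inner_diff_right)
    ultimately show ?thesis using fixed by (intro exI[of _ \<psi>]) (simp add: \<psi>_def inner_diff_right)
  qed
  then obtain \<psi> where \<psi>: "\<psi> \<noteq> 0" "w \<bullet> \<psi> = 0" "\<And>t x. t \<ge> 0 \<Longrightarrow> S t x \<bullet> \<psi> = x \<bullet> \<psi>" by blast
  obtain p where p: "set_integrable lborel {0..\<tau>} p" "S \<tau> \<psi> - duhamel p (\<lambda>_. w) \<tau> = 0"
    using null by blast
  have "duhamel p (\<lambda>_. w) \<tau> \<bullet> \<psi>
      = (LBINT s. (indicator {0..\<tau>} s *\<^sub>R (p s *\<^sub>R S (\<tau> - s) w)) \<bullet> \<psi>)"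
    unfolding duhamel_def set_lebesgue_integral_def
    using integrable_duhamel[OF p(1) continuous_on_const, of \<tau> w]
    by (intro integral_inner_left[symmetric]) (simp add: set_integrable_def)
  also have "\<dots> = 0"
  proof -
    have "(indicator {0..\<tau>} s *\<^sub>R (p s *\<^sub>R S (\<tau> - s) w)) \<bullet> \<psi> = 0" for s
      by (cases "s \<in> {0..\<tau>}") (simp_all add: \<psi>)
    then show ?thesis by (simp only:) simp
  qed
  finally have "S \<tau> \<psi> \<bullet> \<psi> = 0" using p(2) by simp
  then show False using \<psi>(1) \<psi>(3)[of \<tau> \<psi>] \<tau> by simp
qed

lemma norm_S_orthogonal_le:
  assumes t: "t \<ge> 0" and x: "x \<bullet> e = 0"
  shows "norm (S t x) \<le> exp (- (ev 2 - ev 1) * t) * norm x"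
proof (rule norm_le_coord)
  fix k
  show "\<bar>S t x \<bullet> \<phi> (Suc k)\<bar> \<le> exp (- (ev 2 - ev 1) * t) * \<bar>x \<bullet> \<phi> (Suc k)\<bar>"
  proof (cases k)
    case 0
    then show ?thesis using x t by (simp add: inner_S e_def)
  next
    case (Suc j)
    have "ev 2 \<le> ev (Suc k)" using ev_mono[of 1 k] Suc by (simp add: numeral_2_eq_2)
    then have "exp (- gap k * t) \<le> exp (- (ev 2 - ev 1) * t)"
      using t by (simp add: mult_right_mono gap_def)
    then show ?thesis
      using t by (simp add: inner_S abs_mult mult_right_mono)
  qed
qed simp

text \<open>
  Half of the radius \<open>r\<close> is left to the first component, which does not move; the others decay at
  least at the rate of the spectral gap, so any bound \<open>R\<close> on them is brought below \<open>r / 2\<close> in a time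
  depending on \<open>R\<close> only. This is why \<open>r\<close> can be chosen before \<open>R\<close>.
\<close>

lemma waiting_time:
  assumes gap: "ev 1 < ev 2" and "r > 0" "R > 0"
  shows "\<exists>t\<ge>0. \<forall>u0. \<bar>u0 \<bullet> e - 1\<bar> < r / 2 \<and> norm (u0 - (u0 \<bullet> e) *\<^sub>R e) \<le> R \<longrightarrow> norm (S t u0 - e) \<le> r"
proof -
  define \<gamma> where "\<gamma> = ev 2 - ev 1"
  define t where "t = max 0 (ln (2 * R / r) / \<gamma>)"
  have \<gamma>: "\<gamma> > 0" using gap by (simp add: \<gamma>_def)
  have t: "t \<ge> 0" by (simp add: t_def)
  have "ln (2 * R / r) \<le> \<gamma> * t"
    using \<gamma> mult_left_mono[of "ln (2 * R / r) / \<gamma>" t \<gamma>] by (simp add: t_def)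
  then have "2 * R / r \<le> exp (\<gamma> * t)"
    using assms by (metis divide_pos_pos exp_le_cancel_iff exp_ln mult_pos_pos zero_less_numeral)
  then have decay: "exp (- \<gamma> * t) * R \<le> r / 2"
    using assms by (simp add: exp_minus field_simps)
  have "norm (S t u0 - e) \<le> r"
    if u0: "\<bar>u0 \<bullet> e - 1\<bar> < r / 2" "norm (u0 - (u0 \<bullet> e) *\<^sub>R e) \<le> R" for u0
  proof -
    define w where "w = u0 - (u0 \<bullet> e) *\<^sub>R e"
    have "w \<bullet> e = 0" using norm_e by (simp add: w_def inner_diff_left norm_eq_1)
    then have "norm (S t w) \<le> exp (- \<gamma> * t) * norm w"
      unfolding \<gamma>_def by (rule norm_S_orthogonal_le[OF t])
    also have "\<dots> \<le> exp (- \<gamma> * t) * R" using u0(2) by (simp add: w_def)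
    also have "\<dots> \<le> r / 2" by (rule decay)
    finally have Sw: "norm (S t w) \<le> r / 2" .
    have "S t u0 = S t w + (u0 \<bullet> e) *\<^sub>R e"
      using t by (simp add: w_def linear_diff[OF linear_S] linear_scale[OF linear_S] S_e)
    then have "S t u0 - e = S t w + (u0 \<bullet> e - 1) *\<^sub>R e" by (simp add: algebra_simps)
    also have "norm \<dots> \<le> r / 2 + r / 2"
      using Sw u0(1) norm_e by (intro norm_triangle_mono) auto
    finally show ?thesis by simp
  qed
  then show ?thesis using t by blast
qed

text \<open>
  The bilinear term is homogeneous in \<open>u\<close>, so the weight \<open>exp (- ev 1 * t)\<close> passes through it and the
  control stays the same, in contrast to the linearized system.
\<close>

lemma bilinear_solution_of_mild:
  assumes B: "bilinear_system S B b" and w: "bilinear_system.mild S B T p u0 w"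
  shows "bilinear_solution D A B T p u0 (\<lambda>t. exp (- ev 1 * t) *\<^sub>R w t)"
proof -
  interpret bilinear_system S B b by (rule B)
  have w': "continuous_on {0..T} w" "\<And>t. t \<in> {0..T} \<Longrightarrow> w t = S t u0 - duhamel p (\<lambda>s. B (w s)) t"
    using w by (auto simp: mild_def)
  have "exp (ev 1 * s) *\<^sub>R B (exp (- ev 1 * s) *\<^sub>R w s) = B (w s)" for s
    by (simp add: linear_scale[OF linear_B] exp_add[symmetric])
  then show ?thesis
    unfolding bilinear_solution_def mild_solution_def
    using w' by (auto simp: exp_convolution exp_semigroup_eq scaleR_diff_right intro!: continuous_intros)
qed

end

section \<open>Exact controllability to the first eigensolution\<close>

theorem theorem1p4:
  fixes D :: "'a::{real_inner,banach,second_countable_topology} set"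
    and A B :: "'a \<Rightarrow> 'a"
    and ev :: "nat \<Rightarrow> real"
    and \<phi> :: "nat \<Rightarrow> 'a"
    and \<nu> T\<^sub>0 :: real
  assumes "densely_defined_linear D A"
    and "self_adjoint D A"
    and "\<And>x. x \<in> D \<Longrightarrow> A x \<bullet> x \<ge> 0"
    and "\<exists>\<mu>>0. has_compact_inverse D (\<lambda>x. \<mu> *\<^sub>R x + A x)"
    and "eigenbasis D A ev \<phi>"
    and "bounded_linear B"
    and "\<And>T. T > 0 \<Longrightarrow> null_controllable1 D A B (\<phi> 1) T"
    and "\<nu> > 0" and "T\<^sub>0 > 0"
    and "\<And>\<tau>. 0 < \<tau> \<Longrightarrow> \<tau> \<le> T\<^sub>0 \<Longrightarrow> control_cost D A B (\<phi> 1) \<tau> \<le> exp (\<nu> / \<tau>)"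
  shows "\<exists>r\<^sub>1>0. \<forall>R>0. \<exists>T\<^sub>R>0. \<forall>u0.
           \<bar>u0 \<bullet> \<phi> 1 - 1\<bar> < r\<^sub>1 \<and> norm (u0 - (u0 \<bullet> \<phi> 1) *\<^sub>R \<phi> 1) \<le> R \<longrightarrow>
           exactly_controllable_to D A B u0 (eigensolution (ev 1) (\<phi> 1)) T\<^sub>R"
proof -
  interpret spectral_system D A ev \<phi> by unfold_locales fact+
  obtain K where K: "\<And>x. norm (B x) \<le> norm x * K"
    using bounded_linear.pos_bounded[OF assms(6)] by blast
  define b where "b = max 1 K"
  have b: "norm (B x) \<le> b * norm x" for x
    using K[of x] mult_left_mono[of K b "norm x"] by (simp add: b_def mult.commute)
  have ev1: "0 \<le> ev 1" using ev_nonneg[of 0] by simp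
  have null: "\<exists>p. L2_control \<tau> p \<and> L2_norm_control \<tau> p \<le> (2 * exp (ev 1)) * exp (\<nu> / \<tau>) * norm v \<and>
             S \<tau> v - duhamel p (\<lambda>_. B e) \<tau> = 0" if "0 < \<tau>" "\<tau> \<le> min T\<^sub>0 1" for \<tau> v
  proof -
    have "control_cost D A B (\<phi> 1) \<tau> \<le> exp (\<nu> / \<tau>)" using assms(10)[of \<tau>] that by simp
    also have "\<dots> < 2 * exp (\<nu> / \<tau>)" by simp
    finally show ?thesis
      using null_control_moving_frame[OF assms(7), of \<tau> "2 * exp (\<nu> / \<tau>)" v] that by (simp add: mult_ac)
  qed
  interpret steerable_system S B b e "2 * exp (ev 1)" \<nu> "min T\<^sub>0 1"
  proof (intro steerable_system.intro bilinear_system.intro contraction_semigroup_axioms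
      bilinear_system_axioms.intro steerable_system_axioms.intro)
    show "2 * exp (ev 1) \<ge> 1" using exp_ge_add_one_self[of "ev 1"] ev1 by linarith
    show "bounded_linear B" by fact
    show "norm (B x) \<le> b * norm x" for x by (rule b)
    show "b \<ge> 1" by (simp add: b_def)
    show "\<nu> > 0" by fact
    show "min T\<^sub>0 1 > 0" using assms(9) by simp
  qed (use null S_e norm_e in blast)+
  obtain r T where r: "r > 0" and T: "T > 0"
    and steer: "\<And>t0 u0. t0 \<ge> 0 \<Longrightarrow> norm (S t0 u0 - e) \<le> r \<Longrightarrow>
      \<exists>p u. L2_control (t0 + T) p \<and> mild (t0 + T) p u0 u \<and> u (t0 + T) = e"
    using steering by blast
  have gap: "ev 1 < ev 2"
  proof (rule spectral_gap)
    show "min T\<^sub>0 1 > 0" using assms(9) by simp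
    fix v
    obtain p where p: "L2_control (min T\<^sub>0 1) p" "S (min T\<^sub>0 1) v - duhamel p (\<lambda>_. B e) (min T\<^sub>0 1) = 0"
      using null[of "min T\<^sub>0 1" v] assms(9) by auto
    moreover have "set_integrable lborel {0..min T\<^sub>0 1} p"
      by (rule L2_control_imp_L1(1)[OF p(1), of "max 1 (L2_norm_control (min T\<^sub>0 1) p)"]) (use assms(9) in auto)
    ultimately show "\<exists>p. set_integrable lborel {0..min T\<^sub>0 1} p \<and> S (min T\<^sub>0 1) v - duhamel p (\<lambda>_. B e) (min T\<^sub>0 1) = 0"
      by blast
  qed
  show ?thesis
    unfolding e_def[symmetric]
  proof (rule exI[of _ "r / 2"], intro conjI allI impI)
    show "r / 2 > 0" using r by simp
    fix R :: real assume "R > 0"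
    then obtain t0 where t0: "t0 \<ge> 0" and wait: "\<And>u0. \<bar>u0 \<bullet> e - 1\<bar> < r / 2 \<Longrightarrow>
        norm (u0 - (u0 \<bullet> e) *\<^sub>R e) \<le> R \<Longrightarrow> norm (S t0 u0 - e) \<le> r"
      using waiting_time[OF gap r] by blast
    have "exactly_controllable_to D A B u0 (eigensolution (ev 1) e) (t0 + T)"
      if u0: "\<bar>u0 \<bullet> e - 1\<bar> < r / 2 \<and> norm (u0 - (u0 \<bullet> e) *\<^sub>R e) \<le> R" for u0
    proof -
      obtain p u where p: "L2_control (t0 + T) p" and u: "mild (t0 + T) p u0 u" "u (t0 + T) = e"
        using steer[OF t0 wait] u0 by blast
      have "bilinear_solution D A B (t0 + T) p u0 (\<lambda>t. exp (- ev 1 * t) *\<^sub>R u t)"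
        by (rule bilinear_solution_of_mild[OF bilinear_system_axioms u(1)])
      then show ?thesis
        unfolding exactly_controllable_to_def eigensolution_def u(2)[symmetric] using p by blast
    qed
    then show "\<exists>T\<^sub>R>0. \<forall>u0. \<bar>u0 \<bullet> e - 1\<bar> < r / 2 \<and> norm (u0 - (u0 \<bullet> e) *\<^sub>R e) \<le> R \<longrightarrow>
        exactly_controllable_to D A B u0 (eigensolution (ev 1) e) T\<^sub>R"
      using t0 T by (intro exI[of _ "t0 + T"]) auto
  qed
qed

end
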